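(* Let $u,v\in S_{\mathbb{Z}_+}$. For $k\ge 0$ put $V_k(u,v)=\{w\in S_{\mathbb{Z}} : c_{\gamma^k(u),\gamma^k(v)}^{\gamma^k(w)}\neq 0\}$, so that $V_0(u,v)\subseteq V_1(u,v)\subseteq\cdots$. Let $\mathrm{BS}(u,v)$ be the smallest integer $j\ge 0$ such that $V_j(u,v)=V_{j+1}(u,v)=V_{j+2}(u,v)=\cdots$, and let $\mathrm{St}(u,v)$ be the smallest integer $j\ge 0$ such that $V_j(u,v)=V_{j+1}(u,v)$. Then: (a) $\mathrm{BS}(u,v)=\mathrm{St}(u,v)$; (b) $\mathrm{BS}(u,v)\le \max\{i : \theta_i(u)=1 \text{ or } \theta_i(v)=1\}$; (c) $\mathrm{BS}(u,v)=\max_{i\ge 0}\bigl(\lambda_i(u)+\lambda_i(v)-i\bigr)$.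
   Context: $S_{\mathbb{Z}}$ is the group of bijections $w:\mathbb{Z}\to\mathbb{Z}$ fixing all but finitely many integers; $S_{\mathbb{Z}_+}\subseteq S_{\mathbb{Z}}$ is the subgroup of those fixing every integer $\le 0$ (i.e. permutations of the positive integers), and $S_n$ those fixing every integer outside $\{1,\dots,n\}$. The shift $\gamma:S_{\mathbb{Z}}\to S_{\mathbb{Z}}$ is $\gamma(w)(i)=w(i-1)+1$. For $w\in S_{\mathbb{Z}_+}$, $\mathfrak{S}_w\in\mathbb{Q}[x_1,x_2,\dots]$ is the Schubert polynomial (stable under $S_n\hookrightarrow S_{n+1}$); these form a basis, and the Schubert structure constants $c_{u,v}^w$ ($u,v,w\in S_{\mathbb{Z}_+}$) are defined by $\mathfrak{S}_u\mathfrak{S}_v=\sum_w c_{u,v}^w\mathfrak{S}_w$. By convention $c_{u,v}^w=0$ if any of $u,v,w$ is not in $S_{\mathbb{Z}_+}$. For $w\in S_{\mathbb{Z}}$: $\theta_i(w)=1$ if there exists $j>i$ with $w(j)<w(i)$, and $\theta_i(w)=0$ otherwise (equivalently, $\theta_i(w)=1$ iff the $i$th entry $\mathrm{code}(w)_i=|\{j>i: w(j)<w(i)\}|$ of the Lehmer code is nonzero); $\lambda_i(w)=\sum_{j\le i}\theta_j(w)$. *)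

theory Defs
  imports Complex_Main "HOL-Library.Poly_Mapping" "HOL-Combinatorics.Transposition"
begin

definition S_Z :: "(int \<Rightarrow> int) set" where
  "S_Z = {w. bij w \<and> finite {i. w i \<noteq> i}}"

definition S_Zpos :: "(int \<Rightarrow> int) set" where
  "S_Zpos = {w \<in> S_Z. \<forall>i\<le>0. w i = i}"

definition gshift :: "(int \<Rightarrow> int) \<Rightarrow> int \<Rightarrow> int" where
  "gshift w = (\<lambda>i. w (i - 1) + 1)"

text \<open>
  Polynomials with rational coefficients: an element of \<open>int \<Rightarrow>\<^sub>0 nat\<close> is the exponent
  vector of a monomial. Variables are indexed by all integers, as permutations are, but
  only the variables with index at least 1 occur in Schubert polynomials.
\<close>

type_synonym rpoly = "(int \<Rightarrow>\<^sub>0 nat) \<Rightarrow>\<^sub>0 rat"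

definition xvar :: "int \<Rightarrow> rpoly" where
  "xvar i = Poly_Mapping.single (Poly_Mapping.single i 1) 1"

definition cpoly :: "rat \<Rightarrow> rpoly" where
  "cpoly a = Poly_Mapping.single 0 a"

text \<open>
  The action of \<open>s\<^sub>i\<close> on polynomials, exchanging \<open>x\<^sub>i\<close> and \<open>x\<^sub>i\<^sub>+\<^sub>1\<close>. The inner
  \<open>map_key\<close> permutes an exponent vector; the outer one precomposes the coefficient
  function with this map, which is an involution.
\<close>

definition swap_vars :: "int \<Rightarrow> rpoly \<Rightarrow> rpoly" where
  "swap_vars i f = Poly_Mapping.map_key (Poly_Mapping.map_key (transpose i (i + 1))) f"

text \<open>The divided difference \<open>(f - s\<^sub>i f) / (x\<^sub>i - x\<^sub>i\<^sub>+\<^sub>1)\<close>; the division is always exact.\<close>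

definition divdiff :: "int \<Rightarrow> rpoly \<Rightarrow> rpoly" where
  "divdiff i f = (THE g. (xvar i - xvar (i + 1)) * g = f - swap_vars i f)"

definition longest_perm :: "nat \<Rightarrow> int \<Rightarrow> int" where
  "longest_perm n = (\<lambda>i. if 1 \<le> i \<and> i \<le> int n then int n + 1 - i else i)"

text \<open>
  The Lascoux--Schuetzenberger recursion within the symmetric group on \<open>{1..n}\<close>.
  The result depends neither on the chosen chain of descents nor on \<open>n\<close>.
\<close>

inductive schubert_rel :: "nat \<Rightarrow> (int \<Rightarrow> int) \<Rightarrow> rpoly \<Rightarrow> bool" for n :: nat where
  longest: "schubert_rel n (longest_perm n) (\<Prod>i=1..n. xvar (int i) ^ (n - i))"
| descent: "schubert_rel n (w \<circ> transpose i (i + 1)) (divdiff i f)"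
    if "schubert_rel n w f" "1 \<le> i" "i < int n" "w (i + 1) < w i"

definition schubert :: "(int \<Rightarrow> int) \<Rightarrow> rpoly" where
  "schubert w = (THE f. \<exists>n. schubert_rel n w f)"

definition schubert_const :: "(int \<Rightarrow> int) \<Rightarrow> (int \<Rightarrow> int) \<Rightarrow> (int \<Rightarrow> int) \<Rightarrow> rat" where
  "schubert_const u v w =
    (if u \<in> S_Zpos \<and> v \<in> S_Zpos \<and> w \<in> S_Zpos then
       (THE c. finite {z. c z \<noteq> 0} \<and> {z. c z \<noteq> 0} \<subseteq> S_Zpos \<and>
               schubert u * schubert v = (\<Sum>z | c z \<noteq> 0. cpoly (c z) * schubert z)) w
     else 0)"

definition theta :: "int \<Rightarrow> (int \<Rightarrow> int) \<Rightarrow> int" where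
  "theta i w = (if \<exists>j>i. w j < w i then 1 else 0)"

text \<open>
  The sum over all \<open>j \<le> i\<close> has finite support for \<open>w \<in> S_Z\<close>; it is restricted to the
  support because \<open>sum\<close> vanishes on infinite index sets.
\<close>

definition lam :: "int \<Rightarrow> (int \<Rightarrow> int) \<Rightarrow> int" where
  "lam i w = (\<Sum>j | j \<le> i \<and> theta j w \<noteq> 0. theta j w)"

definition V_set :: "nat \<Rightarrow> (int \<Rightarrow> int) \<Rightarrow> (int \<Rightarrow> int) \<Rightarrow> (int \<Rightarrow> int) set" where
  "V_set k u v = {w \<in> S_Z. schubert_const ((gshift ^^ k) u) ((gshift ^^ k) v) ((gshift ^^ k) w) \<noteq> 0}"

definition BS :: "(int \<Rightarrow> int) \<Rightarrow> (int \<Rightarrow> int) \<Rightarrow> nat" where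
  "BS u v = (LEAST j. \<forall>i\<ge>j. V_set i u v = V_set (i + 1) u v)"

definition St :: "(int \<Rightarrow> int) \<Rightarrow> (int \<Rightarrow> int) \<Rightarrow> nat" where
  "St u v = (LEAST j. V_set j u v = V_set (j + 1) u v)"

end

theory Submission
  imports Defs "HOL-Computational_Algebra.Polynomial"
begin

text \<open>
  Setting \<open>x\<^sub>1 = 0\<close> and lowering all other indices is a ring homomorphism that maps
  \<open>\<SS>\<^sub>w\<close> to the Schubert polynomial of the unshifted permutation if \<open>w(1) = 1\<close> and to 0
  otherwise. Hence \<open>V\<^sub>k = V\<^sub>k\<^sub>+\<^sub>1\<close> holds iff all terms of the product \<open>\<SS>\<^sub>U \<SS>\<^sub>V\<close>
  of the \<open>(k+1)\<close>-fold shifts fix 1, and it suffices to show that this is equivalent to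
  \<open>\<lambda>\<^sub>j(U) + \<lambda>\<^sub>j(V) \<le> j - 1\<close> for all \<open>j \<ge> 1\<close>.

  The tool is the family of operators \<open>\<Psi>\<^sub>n\<close> with \<open>\<Psi>\<^sub>0 f = f(x\<^sub>1 = 0)\<close> and
  \<open>\<Psi>\<^sub>n f = s\<^sub>n \<Psi>\<^sub>n\<^sub>-\<^sub>1 f + (x\<^sub>n - x\<^sub>n\<^sub>+\<^sub>1) s\<^sub>n \<Psi>\<^sub>n\<^sub>-\<^sub>1 \<partial>\<^sub>n f\<close>.
  As a polynomial in \<open>x\<^sub>n\<^sub>+\<^sub>1\<close>, \<open>\<Psi>\<^sub>n f\<close> has degree at most n, and for a Schubert polynomial
  \<open>\<SS>\<^sub>w\<close> at most \<open>\<lambda>\<^sub>n(w)\<close>, with equality if w has no descents beyond n. At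
  \<open>x\<^sub>n\<^sub>+\<^sub>1 = 0\<close> it agrees with f, and at \<open>x\<^sub>n\<^sub>+\<^sub>1 = x\<^sub>j\<close> with \<open>\<Psi>\<^sub>j\<^sub>-\<^sub>1 f\<close>.
  Counting roots, \<open>\<Psi>\<^sub>n\<close> is therefore multiplicative on \<open>\<SS>\<^sub>u \<SS>\<^sub>v\<close> as long as
  \<open>\<lambda>\<^sub>m(u) + \<lambda>\<^sub>m(v) \<le> m\<close> for all \<open>m \<le> n\<close>. Comparing degrees gives both implications: the
  coefficient of \<open>x\<^sub>n\<^sub>+\<^sub>1\<^sup>n\<close> in \<open>\<Psi>\<^sub>n f\<close> is up to renaming and sign
  \<open>(\<partial>\<^sub>1 \<dots> \<partial>\<^sub>n f)(x\<^sub>1 = 0)\<close>, which detects exactly the terms w of f with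
  \<open>w(n+1) = 1\<close>. For the converse, leading coefficients in the last variable reduce to u and v
  without descents beyond n.
\<close>

section \<open>Substitution homomorphisms\<close>

lemma update_eq_single_add:
  assumes "a \<notin> Poly_Mapping.keys f"
  shows "Poly_Mapping.update a b f = Poly_Mapping.single a b + f"
  by (rule poly_mapping_eqI)
     (use assms in \<open>auto simp: lookup_update lookup_add lookup_single in_keys_iff when_def\<close>)

lemma single_var_power: "Poly_Mapping.single (Poly_Mapping.single i e) 1 = xvar i ^ e"
proof (induction e)
  case (Suc e)
  have "Poly_Mapping.single (Poly_Mapping.single i (Suc e)) (1::rat)
      = xvar i * Poly_Mapping.single (Poly_Mapping.single i e) 1"
    by (simp add: xvar_def mult_single flip: single_add)
  then show ?case using Suc by simp
qed simp

lemma cpoly_0 [simp]: "cpoly 0 = 0"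
  and cpoly_1 [simp]: "cpoly 1 = 1"
  and cpoly_add: "cpoly (a + b) = cpoly a + cpoly b"
  and cpoly_mult: "cpoly (a * b) = cpoly a * cpoly b"
  and cpoly_uminus: "cpoly (- a) = - cpoly a"
  by (simp_all add: cpoly_def single_add mult_single single_uminus)

lemma cpoly_eq_0_iff [simp]: "cpoly a = 0 \<longleftrightarrow> a = 0"
  by (metis cpoly_def lookup_single_eq lookup_zero single_zero)

lemma xvar_neq_0 [simp]: "xvar i \<noteq> 0"
  unfolding xvar_def by (metis lookup_single_eq lookup_zero one_neq_zero)

lemma xvar_eq_iff [simp]: "xvar i = xvar j \<longleftrightarrow> i = j"
proof
  assume "xvar i = xvar j"
  then have "Poly_Mapping.keys (xvar i) = Poly_Mapping.keys (xvar j)" by simp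
  then have "Poly_Mapping.single i (1::nat) = Poly_Mapping.single j 1"
    by (simp add: xvar_def)
  then have "Poly_Mapping.keys (Poly_Mapping.single i (1::nat)) = Poly_Mapping.keys (Poly_Mapping.single j (1::nat))"
    by simp
  then show "i = j" by simp
qed simp

text \<open>Constants and variables generate the ring, so identities between ring homomorphisms, and
  properties closed under sums and products, only have to be checked on generators.\<close>

lemma rpoly_induct [case_names const var add mult]:
  fixes f :: rpoly
  assumes const: "\<And>a. P (cpoly a)" and var: "\<And>i. P (xvar i)"
    and add: "\<And>f g. P f \<Longrightarrow> P g \<Longrightarrow> P (f + g)"
    and mult: "\<And>f g. P f \<Longrightarrow> P g \<Longrightarrow> P (f * g)"
  shows "P f"
proof -
  have one: "P 1" using const[of 1] by simp
  have pow: "P (xvar i ^ e)" for i e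
    by (induction e) (auto intro: one var mult)
  have mono: "P (Poly_Mapping.single m 1)" for m
  proof (induction m rule: update_induct)
    case const
    then show ?case using one by simp
  next
    case (update m i e)
    have "Poly_Mapping.single (Poly_Mapping.update i e m) (1::rat) = xvar i ^ e * Poly_Mapping.single m 1"
      by (simp add: update_eq_single_add[OF update(1)] mult_single flip: single_var_power)
    then show ?case using update mult pow by simp
  qed
  have sing: "P (Poly_Mapping.single m a)" for m a
  proof -
    have "Poly_Mapping.single m a = cpoly a * Poly_Mapping.single m 1"
      by (simp add: cpoly_def mult_single)
    then show ?thesis using mult const mono by simp
  qed
  show ?thesis
  proof (induction f rule: update_induct)
    case const
    then show ?case using assms(1)[of 0] by simp
  next
    case (update f m a)
    then show ?case by (simp add: update_eq_single_add add sing)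
  qed
qed

text \<open>The evaluation homomorphism along \<open>c\<close> and \<open>\<phi>\<close>. The target
  ring is left open because it is used with \<open>rpoly\<close>, as substitution, and with
  \<open>rpoly poly\<close>, to single out one variable.\<close>

definition psub :: "(rat \<Rightarrow> 'b) \<Rightarrow> (int \<Rightarrow> 'b) \<Rightarrow> rpoly \<Rightarrow> 'b::comm_ring_1" where
  "psub c \<phi> f = (\<Sum>m\<in>Poly_Mapping.keys f. c (Poly_Mapping.lookup f m) *
     (\<Prod>i\<in>Poly_Mapping.keys m. \<phi> i ^ Poly_Mapping.lookup m i))"

locale scalar_hom =
  fixes c :: "rat \<Rightarrow> 'b::comm_ring_1"
  assumes c_0 [simp]: "c 0 = 0" and c_1 [simp]: "c 1 = 1"
    and c_add: "c (a + b) = c a + c b" and c_mult: "c (a * b) = c a * c b"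
begin

lemma psub_add: "psub c \<phi> (f + g) = psub c \<phi> f + psub c \<phi> g"
  unfolding psub_def
  by (rule setsum_keys_plus_distrib) (simp_all add: c_add ring_distribs)

lemma psub_single:
  "psub c \<phi> (Poly_Mapping.single m a) = c a * (\<Prod>i\<in>Poly_Mapping.keys m. \<phi> i ^ Poly_Mapping.lookup m i)"
  by (simp add: psub_def)

lemma prod_keys_superset:
  fixes \<phi> :: "int \<Rightarrow> 'b"
  assumes "finite A" "Poly_Mapping.keys m \<subseteq> A"
  shows "(\<Prod>i\<in>Poly_Mapping.keys m. \<phi> i ^ Poly_Mapping.lookup m i) = (\<Prod>i\<in>A. \<phi> i ^ Poly_Mapping.lookup m i)"
  by (rule prod.mono_neutral_left) (use assms in \<open>auto simp: in_keys_iff\<close>)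

lemma prod_keys_add:
  fixes \<phi> :: "int \<Rightarrow> 'b"
  shows "(\<Prod>i\<in>Poly_Mapping.keys (m + n). \<phi> i ^ Poly_Mapping.lookup (m + n) i) =
    (\<Prod>i\<in>Poly_Mapping.keys m. \<phi> i ^ Poly_Mapping.lookup m i) *
    (\<Prod>i\<in>Poly_Mapping.keys n. \<phi> i ^ Poly_Mapping.lookup n i)"
proof -
  let ?A = "Poly_Mapping.keys m \<union> Poly_Mapping.keys n"
  have "Poly_Mapping.keys (m + n) \<subseteq> ?A" by (rule keys_add)
  then show ?thesis
    by (subst (1 2 3) prod_keys_superset[of ?A]) (auto simp: lookup_add power_add prod.distrib)
qed

lemma psub_mult_single:
  "psub c \<phi> (Poly_Mapping.single m a * g) = psub c \<phi> (Poly_Mapping.single m a) * psub c \<phi> g"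
proof (induction g rule: update_induct)
  case const
  then show ?case by (simp add: psub_def)
next
  case (update g n b)
  then show ?case
    by (simp add: update_eq_single_add ring_distribs psub_add mult_single)
       (simp add: psub_single c_mult prod_keys_add mult_ac)
qed

lemma psub_mult: "psub c \<phi> (f * g) = psub c \<phi> f * psub c \<phi> g"
proof (induction f rule: update_induct)
  case const
  then show ?case by (simp add: psub_def)
next
  case (update f n b)
  then show ?case
    by (simp add: update_eq_single_add ring_distribs psub_add psub_mult_single)
qed

lemma psub_const [simp]: "psub c \<phi> (cpoly a) = c a"
  by (simp add: cpoly_def psub_def)

lemma psub_var [simp]: "psub c \<phi> (xvar i) = \<phi> i"
  by (simp add: xvar_def psub_def)

lemma psub_0 [simp]: "psub c \<phi> 0 = 0"
  and psub_1 [simp]: "psub c \<phi> 1 = 1"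
  using psub_const[of \<phi> 0] psub_const[of \<phi> 1] by simp_all

lemma psub_minus: "psub c \<phi> (- f) = - psub c \<phi> f"
proof -
  have "psub c \<phi> (- f) + psub c \<phi> f = 0"
    using psub_add[of \<phi> "- f" f] by simp
  then show ?thesis by (simp add: eq_neg_iff_add_eq_0)
qed

lemma psub_diff: "psub c \<phi> (f - g) = psub c \<phi> f - psub c \<phi> g"
  using psub_add[of \<phi> f "- g"] by (simp add: psub_minus)

lemma psub_power: "psub c \<phi> (f ^ n) = psub c \<phi> f ^ n"
  by (induction n) (simp_all add: psub_mult)

lemma psub_sum: "psub c \<phi> (\<Sum>x\<in>A. F x) = (\<Sum>x\<in>A. psub c \<phi> (F x))"
  by (induction A rule: infinite_finite_induct) (simp_all add: psub_add)

lemma psub_prod: "psub c \<phi> (\<Prod>x\<in>A. F x) = (\<Prod>x\<in>A. psub c \<phi> (F x))"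
  by (induction A rule: infinite_finite_induct) (simp_all add: psub_mult)

lemmas psub_hom = psub_add psub_mult psub_minus psub_diff psub_power psub_sum psub_prod

end

interpretation cp: scalar_hom cpoly
  by standard (simp_all add: cpoly_add cpoly_mult)

interpretation cpp: scalar_hom "\<lambda>a. [:cpoly a:]"
  by standard (simp_all add: cpoly_add cpoly_mult)

abbreviation subst :: "(int \<Rightarrow> rpoly) \<Rightarrow> rpoly \<Rightarrow> rpoly" where
  "subst \<equiv> psub cpoly"

lemma subst_xvar [simp]: "subst xvar f = f"
  by (induction f rule: rpoly_induct) (simp_all add: cp.psub_hom)

lemma subst_subst: "subst \<phi> (subst \<psi> f) = subst (\<lambda>i. subst \<phi> (\<psi> i)) f"
  by (induction f rule: rpoly_induct) (simp_all add: cp.psub_hom)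

text \<open>Only finitely many variables occur in \<open>f\<close>. Phrased through substitutions,
  this passes to sums and products by uniting the two sets.\<close>

lemma finite_dependence:
  "\<exists>A. finite A \<and> (\<forall>\<phi> \<psi>. (\<forall>i\<in>A. \<phi> i = \<psi> i) \<longrightarrow> subst \<phi> f = subst \<psi> f)"
proof (induction f rule: rpoly_induct)
  case (const a)
  then show ?case by (intro exI[of _ "{}"]) simp
next
  case (var i)
  then show ?case by (intro exI[of _ "{i}"]) simp
next
  case (add f g)
  then obtain A B where "finite A" "finite B"
    "\<forall>\<phi> \<psi>. (\<forall>i\<in>A. \<phi> i = \<psi> i) \<longrightarrow> subst \<phi> f = subst \<psi> f"
    "\<forall>\<phi> \<psi>. (\<forall>i\<in>B. \<phi> i = \<psi> i) \<longrightarrow> subst \<phi> g = subst \<psi> g" by blast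
  then show ?case by (intro exI[of _ "A \<union> B"]) (auto simp: cp.psub_hom intro!: arg_cong2[where f="(+)"])
next
  case (mult f g)
  then obtain A B where "finite A" "finite B"
    "\<forall>\<phi> \<psi>. (\<forall>i\<in>A. \<phi> i = \<psi> i) \<longrightarrow> subst \<phi> f = subst \<psi> f"
    "\<forall>\<phi> \<psi>. (\<forall>i\<in>B. \<phi> i = \<psi> i) \<longrightarrow> subst \<phi> g = subst \<psi> g" by blast
  then show ?case by (intro exI[of _ "A \<union> B"]) (auto simp: cp.psub_hom intro!: arg_cong2[where f="(*)"])
qed

text \<open>With this form \<open>swap_vars\<close> inherits its algebra from \<open>psub\<close>.
  \<open>map_key\<close> precomposes with the transposition, which is its own inverse, so variables
  are renamed by the same transposition.\<close>

lemma swap_vars_eq_subst: "swap_vars i f = subst (\<lambda>j. xvar (transpose i (i + 1) j)) f"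
proof -
  let ?t = "transpose i (i + 1)"
  have inj_t: "inj ?t" by simp
  have tt: "?t \<circ> ?t = id" by auto
  have kk: "Poly_Mapping.map_key ?t (Poly_Mapping.map_key ?t m) = m" for m :: "int \<Rightarrow>\<^sub>0 nat"
    by (simp add: map_key_compose[OF inj_t inj_t] tt map_key_id[folded id_def])
  then have inj_k: "inj (Poly_Mapping.map_key ?t :: (int \<Rightarrow>\<^sub>0 nat) \<Rightarrow> _)"
    by (metis injI)
  have sw_single: "swap_vars i (Poly_Mapping.single m a) = Poly_Mapping.single (Poly_Mapping.map_key ?t m) a" for m a
    using map_key_single[OF inj_k, of "Poly_Mapping.map_key ?t m" a] by (simp add: swap_vars_def kk)
  have sw_add: "swap_vars i (f + g) = swap_vars i f + swap_vars i g" for f g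
    by (simp add: swap_vars_def map_key_plus[OF inj_k])
  have sw_0: "swap_vars i 0 = 0"
    by (simp add: swap_vars_def map_key_zero[OF inj_k])
  have mk: "Poly_Mapping.map_key ?t (Poly_Mapping.single j e) = Poly_Mapping.single (?t j) e" for j and e :: nat
    using map_key_single[OF inj_t, of "?t j" e] by simp
  have mono: "Poly_Mapping.single (Poly_Mapping.map_key ?t m) 1 = subst (\<lambda>j. xvar (?t j)) (Poly_Mapping.single m 1)" for m
  proof (induction m rule: update_induct)
    case const
    then show ?case by (simp add: map_key_zero[OF inj_t])
  next
    case (update m j e)
    have "Poly_Mapping.single (Poly_Mapping.update j e m) (1::rat) = xvar j ^ e * Poly_Mapping.single m 1"
      by (simp add: update_eq_single_add[OF update(1)] mult_single flip: single_var_power)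
    moreover have "Poly_Mapping.single (Poly_Mapping.map_key ?t (Poly_Mapping.update j e m)) (1::rat)
        = xvar (?t j) ^ e * Poly_Mapping.single (Poly_Mapping.map_key ?t m) 1"
      by (simp add: update_eq_single_add[OF update(1)] map_key_plus[OF inj_t] mk mult_single flip: single_var_power)
    ultimately show ?case using update by (simp add: cp.psub_hom)
  qed
  show ?thesis
  proof (induction f rule: update_induct)
    case const
    then show ?case by (simp add: sw_0)
  next
    case (update f m a)
    have 1: "Poly_Mapping.single k a = cpoly a * Poly_Mapping.single k 1" for k
      by (simp add: cpoly_def mult_single)
    have "swap_vars i (Poly_Mapping.single m a) = subst (\<lambda>j. xvar (?t j)) (Poly_Mapping.single m a)"
      by (subst sw_single, subst (1 2) 1) (simp add: mono cp.psub_hom)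
    then show ?case using update by (simp add: update_eq_single_add sw_add cp.psub_hom)
  qed
qed

section \<open>Exchange of adjacent variables\<close>

lemma swap_const [simp]: "swap_vars i (cpoly a) = cpoly a"
  and swap_var: "swap_vars i (xvar j) = xvar (transpose i (i + 1) j)"
  and swap_0 [simp]: "swap_vars i 0 = 0"
  and swap_1 [simp]: "swap_vars i 1 = 1"
  and swap_add: "swap_vars i (f + g) = swap_vars i f + swap_vars i g"
  and swap_mult: "swap_vars i (f * g) = swap_vars i f * swap_vars i g"
  and swap_diff: "swap_vars i (f - g) = swap_vars i f - swap_vars i g"
  and swap_minus: "swap_vars i (- f) = - swap_vars i f"
  and swap_power: "swap_vars i (f ^ n) = swap_vars i f ^ n"
  and swap_sum: "swap_vars i (sum F A) = (\<Sum>x\<in>A. swap_vars i (F x))"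
  by (simp_all add: swap_vars_eq_subst cp.psub_hom)

lemmas swap_hom = swap_add swap_mult swap_diff swap_minus swap_power swap_sum

lemma swap_var_simps [simp]:
  "swap_vars i (xvar i) = xvar (i + 1)"
  "swap_vars i (xvar (i + 1)) = xvar i"
  "j \<noteq> i \<Longrightarrow> j \<noteq> i + 1 \<Longrightarrow> swap_vars i (xvar j) = xvar j"
  by (auto simp: swap_var)

lemma swap_swap [simp]: "swap_vars i (swap_vars i f) = f"
  by (simp add: swap_vars_eq_subst subst_subst)

lemma swap_eq_0_iff [simp]: "swap_vars i f = 0 \<longleftrightarrow> f = 0"
  by (metis swap_0 swap_swap)

lemma subst_swap: "subst \<phi> (swap_vars i f) = subst (\<lambda>j. \<phi> (transpose i (i + 1) j)) f"
  by (simp add: swap_vars_eq_subst subst_subst)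

lemma swap_subst: "swap_vars i (subst \<phi> f) = subst (\<lambda>j. swap_vars i (\<phi> j)) f"
  by (simp add: swap_vars_eq_subst subst_subst)

lemma swap_commute:
  assumes "j \<noteq> i" "j \<noteq> i + 1" "i \<noteq> j + 1"
  shows "swap_vars i (swap_vars j f) = swap_vars j (swap_vars i f)"
  using assms by (auto simp: swap_vars_eq_subst subst_subst transpose_def intro!: arg_cong[where f="\<lambda>\<phi>. subst \<phi> f"])

lemma swap_braid:
  "swap_vars i (swap_vars (i + 1) (swap_vars i f)) = swap_vars (i + 1) (swap_vars i (swap_vars (i + 1) f))"
  by (auto simp: swap_vars_eq_subst subst_subst transpose_def intro!: arg_cong[where f="\<lambda>\<phi>. subst \<phi> f"])

section \<open>Divided differences\<close>

lemma xdiff_neq_0 [simp]: "xvar i - xvar (i + 1) \<noteq> 0" "xvar (i + 1) - xvar i \<noteq> 0"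
  by simp_all

text \<open>On generators the quotient is visible; for a product the twisted Leibniz rule assembles
  it from the quotients of the factors.\<close>

lemma divdiff_exists: "\<exists>g. (xvar i - xvar (i + 1)) * g = f - swap_vars i f"
proof (induction f rule: rpoly_induct)
  case (const a)
  then show ?case by (intro exI[of _ 0]) simp
next
  case (var j)
  consider "j = i" | "j = i + 1" | "j \<noteq> i" "j \<noteq> i + 1" by blast
  then show ?case
  proof cases
    case 1
    then show ?thesis by (intro exI[of _ 1]) simp
  next
    case 2
    then show ?thesis by (intro exI[of _ "-1"]) simp
  next
    case 3
    then show ?thesis by (intro exI[of _ 0]) simp
  qed
next
  case (add f g)
  then obtain f' g' where "(xvar i - xvar (i + 1)) * f' = f - swap_vars i f"
    "(xvar i - xvar (i + 1)) * g' = g - swap_vars i g" by blast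
  then show ?case by (intro exI[of _ "f' + g'"]) (simp add: ring_distribs(1) swap_hom)
next
  case (mult f g)
  then obtain f' g' where fg: "(xvar i - xvar (i + 1)) * f' = f - swap_vars i f"
    "(xvar i - xvar (i + 1)) * g' = g - swap_vars i g" by blast
  have "(xvar i - xvar (i + 1)) * (f' * g + swap_vars i f * g') =
    ((xvar i - xvar (i + 1)) * f') * g + swap_vars i f * ((xvar i - xvar (i + 1)) * g')"
    by (simp add: algebra_simps)
  also have "\<dots> = f * g - swap_vars i (f * g)"
    unfolding fg by (simp add: swap_hom algebra_simps)
  finally show ?case by blast
qed

text \<open>Existence is \<open>divdiff_exists\<close>, uniqueness is cancellation in an integral
  domain. This equation and \<open>divdiff_unique\<close> replace the definite description from here
  on.\<close>

lemma divdiff_eq: "(xvar i - xvar (i + 1)) * divdiff i f = f - swap_vars i f"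
  unfolding divdiff_def
proof (rule theI')
  show "\<exists>!g. (xvar i - xvar (i + 1)) * g = f - swap_vars i f"
    using divdiff_exists[of i f] mult_left_cancel[OF xdiff_neq_0(1)[of i]] by metis
qed

lemma divdiff_unique:
  assumes "(xvar i - xvar (i + 1)) * g = f - swap_vars i f"
  shows "divdiff i f = g"
  using assms divdiff_eq[of i f] mult_left_cancel[OF xdiff_neq_0(1)[of i]] by metis

lemma swap_eq_divdiff: "swap_vars i f = f - (xvar i - xvar (i + 1)) * divdiff i f"
  by (simp add: divdiff_eq)

lemma divdiff_add: "divdiff i (f + g) = divdiff i f + divdiff i g"
  by (rule divdiff_unique) (simp add: ring_distribs(1) divdiff_eq swap_hom)

lemma divdiff_diff: "divdiff i (f - g) = divdiff i f - divdiff i g"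
  by (rule divdiff_unique) (simp add: right_diff_distrib divdiff_eq swap_hom)

lemma divdiff_mult: "divdiff i (f * g) = divdiff i f * g + swap_vars i f * divdiff i g"
proof (rule divdiff_unique)
  have "(xvar i - xvar (i + 1)) * (divdiff i f * g + swap_vars i f * divdiff i g) =
    ((xvar i - xvar (i + 1)) * divdiff i f) * g + swap_vars i f * ((xvar i - xvar (i + 1)) * divdiff i g)"
    by (simp add: algebra_simps)
  also have "\<dots> = f * g - swap_vars i (f * g)"
    unfolding divdiff_eq by (simp add: swap_hom algebra_simps)
  finally show "(xvar i - xvar (i + 1)) * (divdiff i f * g + swap_vars i f * divdiff i g) = f * g - swap_vars i (f * g)" .
qed

lemma divdiff_eq_0_iff: "divdiff i f = 0 \<longleftrightarrow> swap_vars i f = f"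
proof
  assume "divdiff i f = 0"
  then show "swap_vars i f = f" by (simp add: swap_eq_divdiff)
next
  assume "swap_vars i f = f"
  then show "divdiff i f = 0" by (intro divdiff_unique) simp
qed

lemma divdiff_0 [simp]: "divdiff i 0 = 0"
  and divdiff_1 [simp]: "divdiff i 1 = 0"
  and divdiff_const [simp]: "divdiff i (cpoly a) = 0"
  by (simp_all add: divdiff_eq_0_iff)

lemma divdiff_sum: "divdiff i (sum F A) = (\<Sum>x\<in>A. divdiff i (F x))"
  by (induction A rule: infinite_finite_induct) (simp_all add: divdiff_add)

lemma divdiff_mult_invariant: "swap_vars i f = f \<Longrightarrow> divdiff i (f * g) = f * divdiff i g"
  by (simp add: divdiff_mult divdiff_eq_0_iff[THEN iffD2])

lemma divdiff_cmult: "divdiff i (cpoly a * f) = cpoly a * divdiff i f"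
  by (rule divdiff_mult_invariant) simp

text \<open>Under \<open>swap_vars i\<close> both numerator and denominator of the quotient change
  sign.\<close>

lemma swap_divdiff: "swap_vars i (divdiff i f) = divdiff i f"
proof -
  have "swap_vars i ((xvar i - xvar (i + 1)) * divdiff i f) = swap_vars i f - f"
    unfolding divdiff_eq by (simp add: swap_hom)
  then have "(xvar (i + 1) - xvar i) * swap_vars i (divdiff i f) = swap_vars i f - f"
    by (simp add: swap_hom)
  then have "(xvar i - xvar (i + 1)) * swap_vars i (divdiff i f) = f - swap_vars i f"
    by (simp add: algebra_simps)
  then show ?thesis by (rule divdiff_unique[symmetric])
qed

lemma divdiff_divdiff [simp]: "divdiff i (divdiff i f) = 0"
  by (simp add: divdiff_eq_0_iff swap_divdiff)

lemma swap_divdiff_commute: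
  assumes "j \<noteq> i" "j \<noteq> i + 1" "i \<noteq> j + 1"
  shows "swap_vars i (divdiff j f) = divdiff j (swap_vars i f)"
proof (rule divdiff_unique[symmetric])
  have "(xvar j - xvar (j + 1)) * swap_vars i (divdiff j f) = swap_vars i ((xvar j - xvar (j + 1)) * divdiff j f)"
    using assms by (simp add: swap_hom)
  also have "\<dots> = swap_vars i f - swap_vars j (swap_vars i f)"
    unfolding divdiff_eq using assms by (simp add: swap_hom swap_commute)
  finally show "(xvar j - xvar (j + 1)) * swap_vars i (divdiff j f) = swap_vars i f - swap_vars j (swap_vars i f)" .
qed

lemma divdiff_commute:
  assumes "j \<noteq> i" "j \<noteq> i + 1" "i \<noteq> j + 1"
  shows "divdiff i (divdiff j f) = divdiff j (divdiff i f)"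
proof (rule divdiff_unique)
  have "(xvar i - xvar (i + 1)) * divdiff j (divdiff i f) = divdiff j ((xvar i - xvar (i + 1)) * divdiff i f)"
    using assms by (subst divdiff_mult_invariant) (auto simp: swap_hom)
  then show "(xvar i - xvar (i + 1)) * divdiff j (divdiff i f) = divdiff j f - swap_vars i (divdiff j f)"
    using assms by (simp add: divdiff_eq divdiff_diff swap_divdiff_commute)
qed

text \<open>Both sides, multiplied by the Vandermonde product of the three variables, are the antisymmetrization of f.\<close>

lemma divdiff_braid:
  "divdiff i (divdiff (i + 1) (divdiff i f)) = divdiff (i + 1) (divdiff i (divdiff (i + 1) f))"
proof -
  define a b c where "a = xvar i" and "b = xvar (i + 1)" and "c = xvar (i + 2)"
  define s t d e where "s = swap_vars i" and "t = swap_vars (i + 1)"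
    and "d = divdiff i" and "e = divdiff (i + 1)"
  have i2: "i + 1 + 1 = i + 2" by simp
  have sa: "s a = b" "s b = a" "s c = c" "t a = a" "t b = c" "t c = b"
    using swap_var_simps(1)[of "i+1"] swap_var_simps(2)[of "i+1"]
    by (simp_all add: a_def b_def c_def i2 s_def t_def)
  have hom: "s (f + g) = s f + s g" "s (f * g) = s f * s g" "s (f - g) = s f - s g"
    "t (f + g) = t f + t g" "t (f * g) = t f * t g" "t (f - g) = t f - t g" for f g
    by (simp_all add: s_def t_def swap_hom)
  have di: "(a - b) * d g = g - s g" for g
    using divdiff_eq[of i g] by (simp add: a_def b_def d_def s_def)
  have dt: "(b - c) * e g = g - t g" for g
    using divdiff_eq[of "i + 1" g] by (simp add: b_def c_def i2 e_def t_def)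
  have sd: "s (d g) = d g" "t (e g) = e g" for g
    by (simp_all add: s_def t_def d_def e_def swap_divdiff)
  have ne: "a - b \<noteq> 0" "b - c \<noteq> 0" "a - c \<noteq> 0" by (auto simp: a_def b_def c_def)
  have 1: "(a - b) * ((a - c) * ((b - c) * d (e (d f)))) =
     f - s f - t f + t (s f) + s (t f) - s (t (s f))"
  proof -
    have st: "(a - c) * (b - c) * e (d f) = (a - c) * d f - t f + t (s f)"
    proof -
      have "(a - c) * (b - c) * e (d f) = (a - c) * ((b - c) * e (d f))"
        by (simp add: algebra_simps)
      also have "\<dots> = (a - c) * d f - t ((a - b) * d f)"
        unfolding dt by (simp add: hom sa algebra_simps)
      finally show ?thesis unfolding di by (simp add: hom)
    qed
    have "(a - c) * (b - c) * ((a - b) * d (e (d f)))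
      = (a - c) * (b - c) * e (d f) - s ((a - c) * (b - c) * e (d f))"
      unfolding di by (simp add: hom sa algebra_simps)
    also have "\<dots> = (a - c) * d f - t f + t (s f) - s ((a - c) * d f - t f + t (s f))"
      unfolding st ..
    also have "\<dots> = (a - b) * d f - t f + t (s f) + s (t f) - s (t (s f))"
      by (simp add: hom sa sd algebra_simps)
    finally show ?thesis unfolding di[of f] by (simp add: algebra_simps)
  qed
  have 2: "(a - b) * ((a - c) * ((b - c) * e (d (e f)))) =
     f - s f - t f + t (s f) + s (t f) - t (s (t f))"
  proof -
    have st: "(a - b) * (a - c) * d (e f) = (a - c) * e f - s f + s (t f)"
    proof -
      have "(a - b) * (a - c) * d (e f) = (a - c) * ((a - b) * d (e f))"
        by (simp add: algebra_simps)
      also have "\<dots> = (a - c) * e f - s ((b - c) * e f)"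
        unfolding di by (simp add: hom sa algebra_simps)
      finally show ?thesis unfolding dt by (simp add: hom)
    qed
    have "(a - b) * (a - c) * ((b - c) * e (d (e f)))
      = (a - b) * (a - c) * d (e f) - t ((a - b) * (a - c) * d (e f))"
      unfolding dt by (simp add: hom sa algebra_simps)
    also have "\<dots> = (a - c) * e f - s f + s (t f) - t ((a - c) * e f - s f + s (t f))"
      unfolding st ..
    also have "\<dots> = (b - c) * e f - s f + s (t f) + t (s f) - t (s (t f))"
      by (simp add: hom sa sd algebra_simps)
    finally show ?thesis unfolding dt[of f] by (simp add: algebra_simps)
  qed
  have "s (t (s f)) = t (s (t f))"
    by (simp add: s_def t_def swap_braid)
  then have "(a - b) * ((a - c) * ((b - c) * d (e (d f)))) = (a - b) * ((a - c) * ((b - c) * e (d (e f))))"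
    by (simp only: 1 2)
  with ne have "d (e (d f)) = e (d (e f))" by simp
  then show ?thesis by (simp add: d_def e_def)
qed

section \<open>Polynomials as univariate polynomials in one of the variables\<close>

text \<open>Makes degrees, leading coefficients and root counting in the single variable
  \<open>xvar k\<close> available. Coefficients stay in \<open>rpoly\<close>; that they avoid
  \<open>xvar k\<close> is \<open>indep_coeff_kap\<close>.\<close>

definition kap :: "int \<Rightarrow> rpoly \<Rightarrow> rpoly poly" where
  "kap k = psub (\<lambda>a. [:cpoly a:]) (\<lambda>i. if i = k then [:0, 1:] else [:xvar i:])"

lemma kap_const [simp]: "kap k (cpoly a) = [:cpoly a:]"
  and kap_var: "kap k (xvar i) = (if i = k then [:0, 1:] else [:xvar i:])"
  and kap_0 [simp]: "kap k 0 = 0"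
  and kap_1 [simp]: "kap k 1 = 1"
  and kap_add: "kap k (f + g) = kap k f + kap k g"
  and kap_mult: "kap k (f * g) = kap k f * kap k g"
  and kap_diff: "kap k (f - g) = kap k f - kap k g"
  and kap_sum: "kap k (sum F A) = (\<Sum>x\<in>A. kap k (F x))"
  by (simp_all add: kap_def cpp.psub_hom)

lemma poly_kap: "poly (kap k f) a = subst (xvar(k := a)) f"
  by (induction f rule: rpoly_induct) (simp_all add: kap_var kap_add kap_mult cp.psub_hom)

lemma kap_eq_0_iff [simp]: "kap k f = 0 \<longleftrightarrow> f = 0"
proof
  assume "kap k f = 0"
  then show "f = 0" using poly_kap[of k f "xvar k"] by simp
qed simp

text \<open>Absence of the variable \<open>xvar k\<close>. Testing it by a substitution makes it
  compatible with ring operations at once.\<close>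

definition indep :: "int \<Rightarrow> rpoly \<Rightarrow> bool" where
  "indep k f \<longleftrightarrow> subst (xvar(k := 0)) f = f"

lemma subst_cong_indep:
  assumes "indep k f" "\<And>i. i \<noteq> k \<Longrightarrow> \<phi> i = \<psi> i"
  shows "subst \<phi> f = subst \<psi> f"
proof -
  have "subst \<phi> (subst (xvar(k := 0)) f) = subst \<psi> (subst (xvar(k := 0)) f)"
    unfolding subst_subst
    by (rule arg_cong[where f="\<lambda>\<phi>. subst \<phi> f"]) (use assms(2) in \<open>auto simp: fun_eq_iff\<close>)
  then show ?thesis using assms(1) by (simp add: indep_def)
qed

lemma indep_coeff_kap: "indep k (coeff (kap k f) n)"
  unfolding indep_def
proof (induction f arbitrary: n rule: rpoly_induct)
  case (const a)
  then show ?case by (cases n) simp_all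
next
  case (var i)
  then show ?case
  proof (cases "i = k")
    case True
    then show ?thesis by (simp add: kap_var coeff_pCons split: nat.split)
  next
    case False
    then show ?thesis by (cases n) (simp_all add: kap_var)
  qed
next
  case (add f g)
  then show ?case by (simp add: kap_add cp.psub_hom)
next
  case (mult f g)
  then show ?case by (simp add: kap_mult coeff_mult cp.psub_hom)
qed

lemma map_poly_swap_add: "map_poly (swap_vars i) (p + q) = map_poly (swap_vars i) p + map_poly (swap_vars i) q"
  by (rule poly_eqI) (simp add: coeff_map_poly swap_add)

lemma map_poly_swap_mult: "map_poly (swap_vars i) (p * q) = map_poly (swap_vars i) p * map_poly (swap_vars i) q"
  by (rule poly_eqI) (simp add: coeff_map_poly coeff_mult swap_sum swap_mult)

lemma kap_swap: "kap (transpose i (i + 1) k) (swap_vars i f) = map_poly (swap_vars i) (kap k f)"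
proof (induction f rule: rpoly_induct)
  case (const a)
  then show ?case by (simp add: map_poly_pCons)
next
  case (var j)
  then show ?case by (auto simp: kap_var swap_var map_poly_pCons transpose_eq_iff)
next
  case (add f g)
  then show ?case by (simp add: swap_add kap_add map_poly_swap_add)
next
  case (mult f g)
  then show ?case by (simp add: swap_mult kap_mult map_poly_swap_mult)
qed

lemma coeff_kap_swap: "coeff (kap (transpose i (i + 1) k) (swap_vars i f)) n = swap_vars i (coeff (kap k f) n)"
  by (simp add: kap_swap coeff_map_poly)

lemma degree_kap_swap: "degree (kap (transpose i (i + 1) k) (swap_vars i f)) = degree (kap k f)"
  by (simp add: kap_swap degree_map_poly)

lemma coeff_kap_divdiff:
  assumes "k \<noteq> i" "k \<noteq> i + 1"
  shows "coeff (kap k (divdiff i f)) n = divdiff i (coeff (kap k f) n)"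
proof (rule divdiff_unique[symmetric])
  have k: "transpose i (i + 1) k = k" using assms by simp
  have "(xvar i - xvar (i + 1)) * coeff (kap k (divdiff i f)) n = coeff (kap k ((xvar i - xvar (i + 1)) * divdiff i f)) n"
    using assms by (simp add: kap_mult kap_diff kap_var)
  also have "\<dots> = coeff (kap k f) n - swap_vars i (coeff (kap k f) n)"
    unfolding divdiff_eq using coeff_kap_swap[of i k f n] by (simp add: kap_diff k)
  finally show "(xvar i - xvar (i + 1)) * coeff (kap k (divdiff i f)) n = coeff (kap k f) n - swap_vars i (coeff (kap k f) n)" .
qed

lemma indep_swap:
  assumes "indep k f"
  shows "indep (transpose i (i + 1) k) (swap_vars i f)"
proof -
  have "subst (xvar(transpose i (i + 1) k := 0)) (swap_vars i f) = subst (\<lambda>j. xvar (transpose i (i + 1) j)) f"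
    unfolding subst_swap by (rule subst_cong_indep[OF assms]) (auto simp: transpose_def)
  then show ?thesis by (simp add: indep_def swap_vars_eq_subst)
qed

lemma subst_divdiff:
  "(\<phi> i - \<phi> (i + 1)) * subst \<phi> (divdiff i f) = subst \<phi> f - subst \<phi> (swap_vars i f)"
proof -
  have "(\<phi> i - \<phi> (i + 1)) * subst \<phi> (divdiff i f) = subst \<phi> ((xvar i - xvar (i + 1)) * divdiff i f)"
    by (simp add: cp.psub_hom)
  then show ?thesis unfolding divdiff_eq by (simp add: cp.psub_hom)
qed

lemma divdiff_subst_fixed:
  assumes "k \<noteq> i" "k \<noteq> i + 1" "swap_vars i a = a"
  shows "divdiff i (subst (xvar(k := a)) f) = subst (xvar(k := a)) (divdiff i f)"
proof (rule divdiff_unique)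
  have "subst (xvar(k := a)) (swap_vars i f) = swap_vars i (subst (xvar(k := a)) f)"
    unfolding subst_swap swap_subst
    by (rule arg_cong[where f="\<lambda>\<phi>. subst \<phi> f"]) (use assms in \<open>auto simp: fun_eq_iff swap_var transpose_def\<close>)
  then show "(xvar i - xvar (i + 1)) * subst (xvar(k := a)) (divdiff i f) =
      subst (xvar(k := a)) f - swap_vars i (subst (xvar(k := a)) f)"
    using subst_divdiff[of "xvar(k := a)" i f] assms by simp
qed

lemma indep_divdiff:
  assumes "k \<noteq> i" "k \<noteq> i + 1" "indep k f"
  shows "indep k (divdiff i f)"
  using divdiff_subst_fixed[OF assms(1,2), of 0 f] assms(3) by (simp add: indep_def)

lemma indep_const [simp]: "indep k (cpoly a)" "indep k 0" "indep k 1"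
  by (simp_all add: indep_def)

lemma indep_var: "j \<noteq> k \<Longrightarrow> indep k (xvar j)"
  by (simp add: indep_def)

lemma indep_hom: "indep k f \<Longrightarrow> indep k g \<Longrightarrow> indep k (f + g)"
  "indep k f \<Longrightarrow> indep k g \<Longrightarrow> indep k (f - g)"
  "indep k f \<Longrightarrow> indep k g \<Longrightarrow> indep k (f * g)"
  "indep k f \<Longrightarrow> indep k (f ^ n)"
  "(\<And>x. x \<in> A \<Longrightarrow> indep k (F x)) \<Longrightarrow> indep k (sum F A)"
  "(\<And>x. x \<in> A \<Longrightarrow> indep k (F x)) \<Longrightarrow> indep k (prod F A)"
  by (simp_all add: indep_def cp.psub_hom)

lemma swap_indep: "indep i f \<Longrightarrow> indep (i + 1) f \<Longrightarrow> swap_vars i f = f"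
proof -
  assume a: "indep i f" "indep (i + 1) f"
  have "swap_vars i f = subst (\<lambda>j. xvar (transpose i (i + 1) j)) f"
    by (rule swap_vars_eq_subst)
  also have "\<dots> = subst ((\<lambda>j. xvar (transpose i (i + 1) j))(i := xvar i)) f"
    by (rule subst_cong_indep[OF a(1)]) simp
  also have "\<dots> = subst xvar f"
    by (rule subst_cong_indep[OF a(2)]) (auto simp: transpose_def)
  finally show ?thesis by simp
qed

lemma eventually_indep: "\<exists>M. \<forall>m\<ge>M. indep m f"
proof -
  obtain A where A: "finite A" "\<And>\<phi> \<psi>. (\<forall>i\<in>A. \<phi> i = \<psi> i) \<Longrightarrow> subst \<phi> f = subst \<psi> f"
    using finite_dependence[of f] by blast
  have "indep m f" if "m \<ge> Max (insert 0 A) + 1" for m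
  proof -
    have "x \<le> Max (insert 0 A)" if "x \<in> A" for x
      using A(1) that by (intro Max_ge) auto
    with that have "m \<notin> A" by force
    then have "subst (xvar(m := 0)) f = subst xvar f" by (intro A(2)) auto
    then show ?thesis by (simp add: indep_def)
  qed
  then show ?thesis by blast
qed

text \<open>Only finitely many variables occur, so a far one is absent; the symmetries carry this
  absence down, one index at a time, to \<open>m\<close>.\<close>

lemma symmetric_imp_indep:
  assumes sym: "\<And>j. j > N \<Longrightarrow> swap_vars j f = f" and "m > N"
  shows "indep m f"
proof -
  obtain M where M: "\<forall>m\<ge>M. indep m f" using eventually_indep by blast
  have "indep (max M m - int k) f" if "max M m - int k > N" for k
    using that
  proof (induction k)
    case 0
    then show ?case using M by simp
  next
    case (Suc k)
    let ?j = "max M m - int (Suc k)"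
    have "indep (?j + 1) f" using Suc by (simp add: algebra_simps)
    then have "indep ?j (swap_vars ?j f)" using indep_swap[of "?j + 1" f ?j] by simp
    then show ?case using sym Suc.prems by simp
  qed
  from this[of "nat (max M m - m)"] show ?thesis using assms(2) by simp
qed

section \<open>Constant terms\<close>

abbreviation ct :: "rpoly \<Rightarrow> rpoly" where
  "ct \<equiv> subst (\<lambda>_. 0)"

lemma ct_const: "\<exists>a. ct f = cpoly a"
proof (induction f rule: rpoly_induct)
  case (var i)
  then show ?case by (simp add: exI[of _ 0])
qed (auto simp: cp.psub_hom simp flip: cpoly_add cpoly_mult)

text \<open>The finitely many variables that can matter for \<open>f\<close> are set to zero one at
  a time.\<close>

lemma indep_all_imp_ct:
  assumes "\<And>k. indep k f"
  shows "ct f = f"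
proof -
  obtain A where A: "finite A" "\<And>\<phi> \<psi>. (\<forall>i\<in>A. \<phi> i = \<psi> i) \<Longrightarrow> subst \<phi> f = subst \<psi> f"
    using finite_dependence[of f] by blast
  have "subst (\<lambda>i. if i \<in> B then 0 else xvar i) f = f" if "finite B" for B
    using that
  proof (induction B rule: finite_induct)
    case (insert b B)
    have "subst (\<lambda>i. if i \<in> insert b B then 0 else xvar i) f = subst (\<lambda>i. if i \<in> B then 0 else xvar i) f"
      by (rule subst_cong_indep[OF assms[of b]]) simp
    then show ?case using insert by simp
  qed simp
  from this[OF A(1)] A(2)[of "\<lambda>i. if i \<in> A then 0 else xvar i" "\<lambda>_. 0"]
  show ?thesis by simp
qed

definition positive_vars :: "rpoly \<Rightarrow> bool" where
  "positive_vars f \<longleftrightarrow> (\<forall>k\<le>0. indep k f)"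

text \<open>The difference is symmetric in all variables of positive index, hence contains none of
  them; \<open>positive_vars\<close> excludes the others. What remains is a constant, detected by
  \<open>ct\<close>.\<close>

lemma divdiff_ct_determine:
  assumes "positive_vars f" "positive_vars g"
    and "\<And>i. i \<ge> 1 \<Longrightarrow> divdiff i f = divdiff i g" and "ct f = ct g"
  shows "f = g"
proof -
  have "swap_vars j (f - g) = f - g" if "j > 0" for j
    using assms(3)[of j] that by (simp add: divdiff_diff flip: divdiff_eq_0_iff)
  then have "indep k (f - g)" if "k > 0" for k
    using symmetric_imp_indep that by blast
  moreover have "indep k (f - g)" if "k \<le> 0" for k
    using assms(1,2) that by (auto simp: positive_vars_def intro: indep_hom)
  ultimately have "indep k (f - g)" for k by (cases "k > 0") auto
  then have "ct (f - g) = f - g" by (rule indep_all_imp_ct)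
  then show ?thesis using assms(4) by (simp add: cp.psub_hom)
qed

section \<open>Extraction of leading coefficients\<close>

text \<open>Applies \<open>divdiff N\<close> first and \<open>divdiff (N + d - 1)\<close> last. Its
  purpose is \<open>divdiffs_up_leading_coeff\<close>: it extracts the coefficient of
  \<open>xvar N ^ d\<close>.\<close>

fun divdiffs_up :: "nat \<Rightarrow> int \<Rightarrow> rpoly \<Rightarrow> rpoly" where
  "divdiffs_up 0 N f = f"
| "divdiffs_up (Suc d) N f = divdiffs_up d (N + 1) (divdiff N f)"

lemma divdiffs_up_0 [simp]: "divdiffs_up d N 0 = 0"
  by (induction d arbitrary: N) simp_all

lemma divdiffs_up_add: "divdiffs_up d N (f + g) = divdiffs_up d N f + divdiffs_up d N g"
  by (induction d arbitrary: N f g) (simp_all add: divdiff_add)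

lemma divdiffs_up_sum: "divdiffs_up d N (sum F A) = (\<Sum>x\<in>A. divdiffs_up d N (F x))"
  by (induction A rule: infinite_finite_induct) (simp_all add: divdiffs_up_add)

lemma divdiffs_up_mult_invariant:
  "(\<And>j. j \<ge> N \<Longrightarrow> swap_vars j g = g) \<Longrightarrow> divdiffs_up d N (g * h) = g * divdiffs_up d N h"
  by (induction d arbitrary: N h) (simp_all add: divdiff_mult_invariant)

lemma divdiff_var_power:
  "divdiff N (xvar N ^ Suc n) = (\<Sum>p<Suc n. xvar N ^ p * xvar (N + 1) ^ (n - p))"
  by (rule divdiff_unique)
     (simp only: swap_power swap_var_simps diff_power_eq_sum)

lemma divdiffs_up_var_power:
  "i \<le> d \<Longrightarrow> divdiffs_up d N (xvar N ^ i) = (if i = d then 1 else 0)"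
proof (induction d arbitrary: N i)
  case (Suc d)
  show ?case
  proof (cases i)
    case (Suc n)
    have "divdiffs_up (Suc d) N (xvar N ^ i) = (\<Sum>p<Suc n. divdiffs_up d (N + 1) (xvar N ^ p * xvar (N + 1) ^ (n - p)))"
      by (simp only: Suc divdiffs_up.simps divdiff_var_power divdiffs_up_sum)
    also have "\<dots> = (\<Sum>p<Suc n. xvar N ^ p * divdiffs_up d (N + 1) (xvar (N + 1) ^ (n - p)))"
      by (rule sum.cong[OF refl], subst divdiffs_up_mult_invariant) (simp_all add: swap_power)
    also have "\<dots> = (\<Sum>p<Suc n. xvar N ^ p * (if n - p = d then 1 else 0))"
      using Suc.IH[of _ "N + 1"] Suc.prems Suc by (intro sum.cong) auto
    \<comment> \<open>As \<open>n \<le> d\<close>, the exponent \<open>n - p\<close> falls below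
      \<open>d\<close> for every \<open>p > 0\<close>.\<close>
    also have "\<dots> = (\<Sum>p<Suc n. if p = 0 then (if n = d then 1 else 0) else 0)"
      using Suc.prems Suc by (intro sum.cong) auto
    also have "\<dots> = (if n = d then 1 else 0)" by simp
    finally show ?thesis using Suc by simp
  qed simp
qed simp

text \<open>The coefficients of \<open>f\<close> in \<open>xvar N\<close> contain neither
  \<open>xvar N\<close> nor a later variable, so the operators are linear over them and only the
  power \<open>xvar N ^ d\<close> survives.\<close>

lemma divdiffs_up_leading_coeff:
  assumes sym: "\<And>j. j > N \<Longrightarrow> swap_vars j f = f" and deg: "degree (kap N f) \<le> d"
  shows "divdiffs_up d N f = coeff (kap N f) d"
proof -
  let ?c = "\<lambda>i. coeff (kap N f) i"
  have "swap_vars j (?c i) = ?c i" if "j > N" for i j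
    using coeff_kap_swap[of j N f i] sym[OF that] that by simp
  then have ind: "indep m (?c i)" if "m > N" for i m
    using symmetric_imp_indep that by blast
  then have inv: "swap_vars j (?c i) = ?c i" if "j \<ge> N" for i j
    using that by (cases "j = N") (auto intro!: swap_indep indep_coeff_kap)
  have "f = poly (kap N f) (xvar N)" by (simp add: poly_kap)
  also have "\<dots> = (\<Sum>i\<le>degree (kap N f). ?c i * xvar N ^ i)" by (simp add: poly_altdef)
  finally have "divdiffs_up d N f = (\<Sum>i\<le>degree (kap N f). divdiffs_up d N (?c i * xvar N ^ i))"
    using divdiffs_up_sum by metis
  also have "\<dots> = (\<Sum>i\<le>degree (kap N f). ?c i * (if i = d then 1 else 0))"
    using deg by (intro sum.cong refl, subst divdiffs_up_mult_invariant) (auto simp: inv divdiffs_up_var_power)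
  also have "\<dots> = ?c d"
    using deg by (auto simp: if_distrib sum.delta coeff_eq_0 cong: if_cong)
  finally show ?thesis .
qed

section \<open>The operators \<open>Psi\<close>\<close>

text \<open>An interpolation in \<open>xvar (int n + 1)\<close>: the degree bound
  \<open>degree_kap_Psi\<close> and the values at the \<open>n + 1\<close> points in
  \<open>Psi_at_zero\<close> and \<open>Psi_at_var\<close> determine \<open>Psi n f\<close>.\<close>

fun Psi :: "nat \<Rightarrow> rpoly \<Rightarrow> rpoly" where
  "Psi 0 f = subst (xvar(1 := 0)) f"
| "Psi (Suc n) f = swap_vars (int n + 1) (Psi n f) +
     (xvar (int n + 1) - xvar (int n + 2)) * swap_vars (int n + 1) (Psi n (divdiff (int n + 1) f))"

lemma Psi_0 [simp]: "Psi n 0 = 0"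
  by (induction n) simp_all

lemma Psi_add: "Psi n (f + g) = Psi n f + Psi n g"
  by (induction n arbitrary: f g) (simp_all add: cp.psub_hom divdiff_add swap_hom algebra_simps)

lemma Psi_cmult: "Psi n (cpoly a * f) = cpoly a * Psi n f"
  by (induction n arbitrary: f)
     (simp_all add: cp.psub_hom divdiff_cmult swap_hom distrib_left mult.left_commute[of _ "cpoly a"])

lemma Psi_sum: "Psi n (sum F A) = (\<Sum>x\<in>A. Psi n (F x))"
  by (induction A rule: infinite_finite_induct) (simp_all add: Psi_add)

text \<open>The swap turns the distinguished variable \<open>xvar (int n + 1)\<close> of
  \<open>Psi n\<close> into \<open>xvar (int n + 2)\<close>, in which the remaining factor is
  linear.\<close>

lemma kap_Psi_Suc:
  "kap (int n + 2) (Psi (Suc n) f) = map_poly (swap_vars (int n + 1)) (kap (int n + 1) (Psi n f)) +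
     [:xvar (int n + 1), -1:] * map_poly (swap_vars (int n + 1)) (kap (int n + 1) (Psi n (divdiff (int n + 1) f)))"
  using kap_swap[of "int n + 1" "int n + 1" "Psi n f"]
    kap_swap[of "int n + 1" "int n + 1" "Psi n (divdiff (int n + 1) f)"]
  by (simp add: kap_add kap_mult kap_diff kap_var add.assoc)

lemma degree_kap_Psi_Suc:
  assumes "degree (kap (int n + 1) (Psi n f)) \<le> Suc d"
    and "degree (kap (int n + 1) (Psi n (divdiff (int n + 1) f))) \<le> d"
  shows "degree (kap (int n + 2) (Psi (Suc n) f)) \<le> Suc d"
  unfolding kap_Psi_Suc
proof (rule degree_add_le)
  show "degree (map_poly (swap_vars (int n + 1)) (kap (int n + 1) (Psi n f))) \<le> Suc d"
    using assms(1) by (simp add: degree_map_poly)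
  show "degree ([:xvar (int n + 1), -1:] * map_poly (swap_vars (int n + 1))
       (kap (int n + 1) (Psi n (divdiff (int n + 1) f)))) \<le> Suc d"
    by (rule order_trans[OF degree_mult_le]) (use assms(2) in \<open>simp add: degree_map_poly\<close>)
qed

lemma degree_kap_Psi: "degree (kap (int n + 1) (Psi n f)) \<le> n"
proof (induction n arbitrary: f)
  case 0
  have "indep 1 (subst (xvar(1 := 0)) f)"
    unfolding indep_def subst_subst by (rule arg_cong[where f="\<lambda>\<phi>. subst \<phi> f"]) auto
  \<comment> \<open>A univariate polynomial with the same value at every point of this infinite ring
    is constant.\<close>
  then have *: "poly (kap 1 (subst (xvar(1 := 0)) f)) a = subst (xvar(1 := 0)) f" for a
    unfolding poly_kap using subst_cong_indep[of 1 "subst (xvar(1 := 0)) f" "xvar(1 := a)" xvar] by simp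
  have "kap 1 (subst (xvar(1 := 0)) f) = [:subst (xvar(1 := 0)) f:]"
    by (rule poly_eq_poly_eq_iff[THEN iffD1]) (simp add: fun_eq_iff *)
  then show ?case by simp
next
  case (Suc n)
  show ?case
    using degree_kap_Psi_Suc[of n f n] Suc[of f] Suc[of "divdiff (int n + 1) f"] by (simp add: algebra_simps)
qed

text \<open>The first summand of \<open>kap_Psi_Suc\<close> has too small a degree to contribute;
  the sign is the leading coefficient \<open>-1\<close> of the linear factor.\<close>

lemma coeff_kap_Psi_Suc:
  assumes "degree (kap (int n + 1) (Psi n f)) \<le> d"
    and "degree (kap (int n + 1) (Psi n (divdiff (int n + 1) f))) \<le> d"
  shows "coeff (kap (int n + 2) (Psi (Suc n) f)) (Suc d) =
    - swap_vars (int n + 1) (coeff (kap (int n + 1) (Psi n (divdiff (int n + 1) f))) d)"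
  unfolding kap_Psi_Suc using assms by (simp add: coeff_map_poly coeff_eq_0)

text \<open>At the point 0 the recursion collapses to
  \<open>swap_vars i f + (xvar i - xvar (i + 1)) * divdiff i f\<close>, which is \<open>f\<close>;
  this uses that \<open>divdiff i f\<close> is invariant under the swap.\<close>

lemma Psi_at_zero: "subst (xvar(int n + 1 := 0)) (Psi n f) = subst (xvar(int n + 1 := 0)) f"
proof (induction n arbitrary: f)
  case 0
  show ?case
    by (simp add: subst_subst) (rule arg_cong[where f="\<lambda>\<phi>. subst \<phi> f"], auto)
next
  case (Suc n)
  let ?i = "int n + 1"
  have sub: "subst (xvar(int n + 2 := 0)) (swap_vars ?i g) = swap_vars ?i (subst (xvar(?i := 0)) g)" for g
    unfolding subst_swap swap_subst
    by (rule arg_cong[where f="\<lambda>\<phi>. subst \<phi> g"]) (auto simp: fun_eq_iff swap_var transpose_def)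
  have "subst (xvar(int n + 2 := 0)) (Psi (Suc n) f)
      = swap_vars ?i (subst (xvar(?i := 0)) (Psi n f)) + xvar ?i * swap_vars ?i (subst (xvar(?i := 0)) (Psi n (divdiff ?i f)))"
    by (simp add: cp.psub_hom sub)
  also have "\<dots> = swap_vars ?i (subst (xvar(?i := 0)) f) + xvar ?i * swap_vars ?i (subst (xvar(?i := 0)) (divdiff ?i f))"
    by (simp only: Suc)
  also have "\<dots> = subst (xvar(int n + 2 := 0)) (swap_vars ?i f + (xvar ?i - xvar (?i + 1)) * divdiff ?i f)"
    using swap_divdiff[of ?i f] sub[of "divdiff ?i f"] by (simp add: cp.psub_hom sub add.assoc)
  finally have "subst (xvar(int n + 2 := 0)) (Psi (Suc n) f) = subst (xvar(int n + 2 := 0)) f"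
    unfolding divdiff_eq by simp
  moreover have "int (Suc n) + 1 = int n + 2" by simp
  ultimately show ?case by (simp only:)
qed

text \<open>\<open>Psi n\<close> acts only on variables up to index \<open>n + 1\<close>, and
  \<open>divdiff k\<close> only on \<open>xvar k\<close> and \<open>xvar (k + 1)\<close>.\<close>

lemma Psi_divdiff_commute: "k \<ge> int n + 2 \<Longrightarrow> Psi n (divdiff k f) = divdiff k (Psi n f)"
proof (induction n arbitrary: f)
  case 0
  then show ?case by (simp add: divdiff_subst_fixed)
next
  case (Suc n)
  let ?i = "int n + 1"
  have inv: "swap_vars k (xvar ?i - xvar (int n + 2)) = xvar ?i - xvar (int n + 2)"
    using Suc.prems by (simp add: swap_hom)
  show ?case
    using Suc.prems
    by (simp add: divdiff_add divdiff_mult_invariant[OF inv] divdiff_commute[of k ?i] Suc.IH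
       swap_divdiff_commute[of k ?i])
qed

lemma Psi_at_var:
  "j < n \<Longrightarrow> subst (xvar(int n + 1 := xvar (int j + 1))) (Psi n f) = subst (xvar(int n + 1 := xvar (int j + 1))) (Psi j f)"
proof (induction n arbitrary: f)
  case (Suc n)
  let ?i = "int n + 1" and ?a = "xvar (int j + 1)"
  let ?\<sigma> = "subst (xvar(int n + 2 := ?a))"
  have e: "int (Suc n) + 1 = int n + 2" by simp
  show ?case
  proof (cases "j = n")
    case True
    \<comment> \<open>The two swapped variables take the same value here, which also kills the
      second summand of the recursion.\<close>
    have "?\<sigma> (swap_vars ?i g) = ?\<sigma> g" for g
      unfolding subst_swap using True
      by (intro arg_cong[where f="\<lambda>\<phi>. subst \<phi> g"]) (auto simp: fun_eq_iff transpose_def)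
    then have "?\<sigma> (Psi (Suc n) f) = ?\<sigma> (Psi j f)"
      using True by (simp add: cp.psub_hom)
    then show ?thesis by (simp only: e)
  next
    case False
    then have j: "j < n" using Suc.prems by simp
    have sub: "?\<sigma> (swap_vars ?i g) = swap_vars ?i (subst (xvar(?i := ?a)) g)" for g
      unfolding subst_swap swap_subst using j
      by (intro arg_cong[where f="\<lambda>\<phi>. subst \<phi> g"]) (auto simp: fun_eq_iff swap_var transpose_def)
    have IH: "subst (xvar(?i := ?a)) (Psi n g) = subst (xvar(?i := ?a)) (Psi j g)" for g
      by (rule Suc.IH[OF j])
    have "?\<sigma> (Psi (Suc n) f) = ?\<sigma> (swap_vars ?i (Psi j f)) + (xvar ?i - ?a) * ?\<sigma> (swap_vars ?i (Psi j (divdiff ?i f)))"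
      by (simp add: cp.psub_hom sub IH)
    \<comment> \<open>As \<open>j < n\<close>, \<open>Psi j\<close> commutes with
      \<open>divdiff ?i\<close>, and the recursion collapses as in
      \<open>Psi_at_zero\<close>.\<close>
    also have "\<dots> = ?\<sigma> (swap_vars ?i (Psi j f) + (xvar ?i - xvar (?i + 1)) * swap_vars ?i (divdiff ?i (Psi j f)))"
      using j by (simp add: cp.psub_hom Psi_divdiff_commute add.assoc)
    finally have "?\<sigma> (Psi (Suc n) f) = ?\<sigma> (Psi j f)"
      unfolding swap_divdiff divdiff_eq by simp
    then show ?thesis by (simp only: e)
  qed
qed simp

text \<open>The difference of the two sides is, as a polynomial in \<open>x\<^sub>n\<^sub>+\<^sub>1\<close>, of degree at most n
  and vanishes at \<open>0, x\<^sub>1, \<dots>, x\<^sub>n\<close>.\<close>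

lemma Psi_mult:
  assumes "\<And>m. m \<le> n \<Longrightarrow> degree (kap (int m + 1) (Psi m f)) + degree (kap (int m + 1) (Psi m g)) \<le> m"
  shows "Psi n (f * g) = Psi n f * Psi n g"
  using assms
proof (induction n rule: less_induct)
  case (less n)
  let ?k = "int n + 1"
  define h where "h = Psi n (f * g) - Psi n f * Psi n g"
  define R where "R = insert 0 (xvar ` {1..int n})"
  have deg: "degree (kap ?k h) \<le> n"
    unfolding h_def kap_diff kap_mult
    by (intro degree_diff_le degree_kap_Psi order_trans[OF degree_mult_le]) (use less.prems in auto)
  have root: "poly (kap ?k h) a = 0" if "a \<in> R" for a
  proof (cases "a = 0")
    case True
    then show ?thesis by (simp add: h_def poly_kap cp.psub_hom Psi_at_zero)
  next
    case False
    with that obtain i where i: "1 \<le> i" "i \<le> int n" "a = xvar i" by (auto simp: R_def)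
    define j where "j = nat (i - 1)"
    have j: "j < n" "a = xvar (int j + 1)" using i by (auto simp: j_def)
    have "Psi j (f * g) = Psi j f * Psi j g"
      by (rule less.IH[OF j(1)]) (use less.prems j in auto)
    then show ?thesis by (simp add: h_def poly_kap cp.psub_hom j Psi_at_var[OF j(1)])
  qed
  have "card R = Suc n"
    by (auto simp: R_def card_insert_if card_image inj_on_def)
  have "kap ?k h = 0"
  proof (rule ccontr)
    assume "kap ?k h \<noteq> 0"
    then have "finite {x. poly (kap ?k h) x = 0}" "card {x. poly (kap ?k h) x = 0} \<le> degree (kap ?k h)"
      by (auto simp: poly_roots_finite intro: card_poly_roots_bound)
    moreover have "R \<subseteq> {x. poly (kap ?k h) x = 0}" using root by auto
    ultimately have "card R \<le> n" using deg by (meson card_mono order_trans)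
    then show False using \<open>card R = Suc n\<close> by simp
  qed
  then show ?case by (simp add: h_def)
qed

text \<open>Applies \<open>divdiff (int n)\<close> first and \<open>divdiff 1\<close> last, the
  order in which unfolding \<open>Psi n\<close> produces them.\<close>

fun divdiffs_down :: "nat \<Rightarrow> rpoly \<Rightarrow> rpoly" where
  "divdiffs_down 0 f = f"
| "divdiffs_down (Suc n) f = divdiffs_down n (divdiff (int n + 1) f)"

text \<open>Each use of \<open>coeff_kap_Psi_Suc\<close> peels off one divided difference; the signs
  and swaps it introduces do not affect vanishing.\<close>

lemma top_coeff_Psi:
  "coeff (kap (int n + 1) (Psi n f)) n = 0 \<Longrightarrow> subst (xvar(1 := 0)) (divdiffs_down n f) = 0"
proof (induction n arbitrary: f)
  case 0
  have "degree (kap 1 (Psi 0 f)) = 0" using degree_kap_Psi[of 0 f] by simp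
  then obtain a where "kap 1 (Psi 0 f) = [:a:]" by (rule degree_eq_zeroE)
  with 0 have "kap 1 (Psi 0 f) = 0" by simp
  then have "Psi 0 f = 0" by (simp only: kap_eq_0_iff)
  then show ?case by (simp only: Psi.simps divdiffs_down.simps)
next
  case (Suc n)
  have "coeff (kap (int n + 1) (Psi n (divdiff (int n + 1) f))) n = 0"
    using Suc.prems coeff_kap_Psi_Suc[of n f n] degree_kap_Psi by (simp add: add.commute)
  then show ?case using Suc.IH by simp
qed

section \<open>Permutations and their inversions\<close>

abbreviation adj :: "int \<Rightarrow> int \<Rightarrow> int" where
  "adj i \<equiv> transpose i (i + 1)"

definition inversions :: "(int \<Rightarrow> int) \<Rightarrow> (int \<times> int) set" where
  "inversions w = {(a, b). a < b \<and> w b < w a}"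

definition len :: "(int \<Rightarrow> int) \<Rightarrow> nat" where
  "len w = card (inversions w)"

definition perm_on :: "nat \<Rightarrow> (int \<Rightarrow> int) \<Rightarrow> bool" where
  "perm_on n w \<longleftrightarrow> bij w \<and> (\<forall>i. i < 1 \<or> i > int n \<longrightarrow> w i = i)"

lemma perm_on_inj: "perm_on n w \<Longrightarrow> w a = w b \<longleftrightarrow> a = b"
  by (auto simp: perm_on_def bij_def dest: injD)

lemma perm_on_range:
  assumes "perm_on n w" "1 \<le> i" "i \<le> int n"
  shows "1 \<le> w i" "w i \<le> int n"
proof -
  have "w (w i) = w i" if "w i < 1 \<or> w i > int n"
    using assms(1) that by (auto simp: perm_on_def)
  then have *: "w i = i" if "w i < 1 \<or> w i > int n"
    using that perm_on_inj[OF assms(1)] by blast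
  have "\<not> (w i < 1 \<or> w i > int n)"
  proof
    assume "w i < 1 \<or> w i > int n"
    with *[OF this] assms(2,3) show False by simp
  qed
  then show "1 \<le> w i" "w i \<le> int n" by simp_all
qed

lemma perm_on_mono: "perm_on n w \<Longrightarrow> n \<le> m \<Longrightarrow> perm_on m w"
  by (auto simp: perm_on_def)

lemma perm_on_S_Zpos: "perm_on n w \<Longrightarrow> w \<in> S_Zpos"
proof -
  assume w: "perm_on n w"
  then have "{i. w i \<noteq> i} \<subseteq> {1..int n}" by (force simp: perm_on_def)
  then have "finite {i. w i \<noteq> i}" by (rule finite_subset) simp
  with w show ?thesis by (auto simp: perm_on_def S_Zpos_def S_Z_def)
qed

lemma S_Zpos_perm_on: "w \<in> S_Zpos \<Longrightarrow> \<exists>n. perm_on n w"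
proof -
  assume w: "w \<in> S_Zpos"
  define n where "n = nat (Max (insert 0 {i. w i \<noteq> i}))"
  have "w i = i" if "i > int n" for i
  proof (rule ccontr)
    assume "w i \<noteq> i"
    then have "i \<le> Max (insert 0 {i. w i \<noteq> i})"
      using w by (intro Max_ge) (auto simp: S_Zpos_def S_Z_def)
    then show False using that unfolding n_def by linarith
  qed
  then have "perm_on n w" using w by (auto simp: perm_on_def S_Zpos_def S_Z_def)
  then show ?thesis ..
qed

lemma S_Zpos_inj: "w \<in> S_Zpos \<Longrightarrow> w a = w b \<longleftrightarrow> a = b"
  using S_Zpos_perm_on perm_on_inj by blast

lemma S_Zpos_pos: "w \<in> S_Zpos \<Longrightarrow> 1 \<le> i \<Longrightarrow> 1 \<le> w i"
proof -
  assume w: "w \<in> S_Zpos" and i: "1 \<le> i"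
  then obtain n where n: "perm_on n w" using S_Zpos_perm_on by blast
  then show "1 \<le> w i"
    using i perm_on_range(1)[OF n] by (cases "i \<le> int n") (auto simp: perm_on_def)
qed

lemma id_S_Zpos [simp]: "id \<in> S_Zpos"
  by (simp add: S_Zpos_def S_Z_def)

lemma perm_on_adj:
  assumes "perm_on n w" "1 \<le> i" "i < int n"
  shows "perm_on n (w \<circ> adj i)"
  using assms by (auto simp: perm_on_def transpose_def intro!: bij_comp)

lemma S_Zpos_adj:
  assumes "w \<in> S_Zpos" "1 \<le> i"
  shows "w \<circ> adj i \<in> S_Zpos"
proof -
  obtain n where "perm_on n w" using S_Zpos_perm_on assms(1) by blast
  then have "perm_on (n + nat i + 1) w" by (rule perm_on_mono) simp
  then have "perm_on (n + nat i + 1) (w \<circ> adj i)"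
    by (rule perm_on_adj) (use assms in auto)
  then show ?thesis by (rule perm_on_S_Zpos)
qed

lemma comp_adj_adj [simp]: "w \<circ> adj i \<circ> adj i = w"
  by (simp add: comp_assoc)

lemma inversions_perm_on:
  assumes "perm_on n w"
  shows "inversions w \<subseteq> {1..int n} \<times> {1..int n}"
proof -
  have w: "w i = i \<or> (1 \<le> i \<and> i \<le> int n \<and> 1 \<le> w i \<and> w i \<le> int n)" for i
    using perm_on_range[OF assms, of i] assms by (cases "1 \<le> i \<and> i \<le> int n") (auto simp: perm_on_def)
  have fx: "w i = i" if "i < 1 \<or> i > int n" for i
    using that assms by (auto simp: perm_on_def)
  {
    fix a b assume ab: "a < b" "w b < w a"
    have "1 \<le> a" "a \<le> int n" "1 \<le> b" "b \<le> int n"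
      using ab w[of a] w[of b] fx[of a] fx[of b] by linarith+
  }
  then show ?thesis by (auto simp: inversions_def)
qed

lemma len_le: "perm_on n w \<Longrightarrow> len w \<le> n * n"
  unfolding len_def using card_mono[OF _ inversions_perm_on, of n w] by (simp add: card_cartesian_product)

lemma adj_less: "a < b \<Longrightarrow> (a, b) \<noteq> (i, i + 1) \<Longrightarrow> adj i a < adj i b"
  by (auto simp: transpose_def)

text \<open>Relabelling positions by \<open>adj i\<close> keeps the order of every pair except
  \<open>(i, i + 1)\<close>, so it maps the other inversions of \<open>w\<close> bijectively onto
  those of \<open>w \<circ> adj i\<close>.\<close>

lemma len_adj:
  assumes "w \<in> S_Zpos" "w (i + 1) < w i"
  shows "len w = Suc (len (w \<circ> adj i))"
proof -
  let ?m = "map_prod (adj i) (adj i)"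
  have "inversions (w \<circ> adj i) = ?m ` (inversions w - {(i, i + 1)})"
  proof (intro set_eqI iffI)
    fix x assume "x \<in> inversions (w \<circ> adj i)"
    then obtain a b where x: "x = (a, b)" "a < b" "w (adj i b) < w (adj i a)"
      by (auto simp: inversions_def)
    then have ne: "(a, b) \<noteq> (i, i + 1)" using assms(2) by auto
    have "(adj i a, adj i b) \<noteq> (i, i + 1)"
      using x(2) by (auto simp: transpose_def split: if_splits)
    then have "(adj i a, adj i b) \<in> inversions w - {(i, i + 1)}"
      using x adj_less[OF x(2) ne] by (simp add: inversions_def)
    moreover have "x = ?m (adj i a, adj i b)" using x by simp
    ultimately show "x \<in> ?m ` (inversions w - {(i, i + 1)})" by blast
  next
    fix x assume "x \<in> ?m ` (inversions w - {(i, i + 1)})"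
    then obtain a b where x: "x = (adj i a, adj i b)" "a < b" "w b < w a" "(a, b) \<noteq> (i, i + 1)"
      by (auto simp: inversions_def)
    then show "x \<in> inversions (w \<circ> adj i)" using adj_less[OF x(2,4)] by (simp add: inversions_def)
  qed
  moreover have "inj ?m" by (simp add: prod.inj_map)
  ultimately have "len (w \<circ> adj i) = card (inversions w - {(i, i + 1)})"
    unfolding len_def by (simp add: card_image inj_on_subset)
  moreover have "finite (inversions w)"
    using S_Zpos_perm_on[OF assms(1)] inversions_perm_on finite_subset by blast
  moreover have "(i, i + 1) \<in> inversions w" using assms(2) by (simp add: inversions_def)
  ultimately show ?thesis unfolding len_def by (metis card_Suc_Diff1)
qed

lemma increasing_ge:
  fixes w :: "int \<Rightarrow> int"
  assumes "\<And>i. i \<ge> a \<Longrightarrow> w i < w (i + 1)" "a \<le> b"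
  shows "w b \<ge> w a + (b - a)"
proof -
  have "w (a + int k) \<ge> w a + int k" for k
  proof (induction k)
    case (Suc k)
    then show ?case using assms(1)[of "a + int k"] by (simp add: algebra_simps)
  qed simp
  from this[of "nat (b - a)"] show ?thesis using assms(2) by simp
qed

lemma S_Zpos_increasing_id:
  assumes "w \<in> S_Zpos" "\<And>i. i \<ge> 1 \<Longrightarrow> w i < w (i + 1)"
  shows "w = id"
proof
  fix i
  obtain n where n: "perm_on n w" using S_Zpos_perm_on assms(1) by blast
  show "w i = id i"
  proof (cases "i \<ge> 1")
    case True
    have "w i \<ge> i"
      using increasing_ge[of 1 w i] assms True S_Zpos_pos[OF assms(1), of 1] by auto
    \<comment> \<open>A fixed point beyond the support bounds the earlier values from above.\<close>
    moreover have "w (max i (int n + 1)) = max i (int n + 1)" using n by (simp add: perm_on_def)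
    moreover have "w (max i (int n + 1)) \<ge> w i + (max i (int n + 1) - i)"
      using assms(2) True by (intro increasing_ge) auto
    ultimately show ?thesis by simp
  next
    case False
    then show ?thesis using assms(1) by (simp add: S_Zpos_def)
  qed
qed

lemma exists_descent:
  assumes "w \<in> S_Zpos" "w \<noteq> id"
  shows "\<exists>i\<ge>1. w (i + 1) < w i"
proof (rule ccontr)
  assume "\<not> ?thesis"
  then have "w i < w (i + 1)" if "i \<ge> 1" for i
    using S_Zpos_inj[OF assms(1), of i "i + 1"] that by force
  then show False using S_Zpos_increasing_id assms by blast
qed

section \<open>Schubert polynomials are well defined\<close>

lemma longest_perm_perm_on: "perm_on n (longest_perm n)"
proof -
  have "longest_perm n \<circ> longest_perm n = id" by (auto simp: longest_perm_def)
  then have "bij (longest_perm n)" by (rule o_bij) fact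
  then show ?thesis by (auto simp: perm_on_def longest_perm_def)
qed

text \<open>The values drop by at least 1 at each step and stay between 1 and \<open>n\<close>,
  which leaves no slack.\<close>

lemma no_ascent_longest_perm:
  assumes w: "perm_on n w" and desc: "\<And>i. 1 \<le> i \<Longrightarrow> i < int n \<Longrightarrow> w (i + 1) < w i"
  shows "w = longest_perm n"
proof
  fix i
  have step: "w (a + int k) \<le> w a - int k" if "1 \<le> a" "a + int k \<le> int n" for a k
    using that(2)
  proof (induction k)
    case (Suc k)
    then show ?case using desc[of "a + int k"] that(1) by (simp add: algebra_simps)
  qed simp
  show "w i = longest_perm n i"
  proof (cases "1 \<le> i \<and> i \<le> int n")
    case True
    have "w i \<le> w 1 - (i - 1)" using step[of 1 "nat (i - 1)"] True by simp
    moreover have "w 1 \<le> int n" using perm_on_range[OF w, of 1] True by simp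
    moreover have "w (int n) \<le> w i - (int n - i)" using step[of i "nat (int n - i)"] True by simp
    moreover have "w (int n) \<ge> 1" using perm_on_range[OF w, of "int n"] True by simp
    ultimately show ?thesis using True by (simp add: longest_perm_def)
  next
    case False
    then show ?thesis using w by (auto simp: perm_on_def longest_perm_def)
  qed
qed

lemma schubert_rel_perm_on: "schubert_rel n w f \<Longrightarrow> perm_on n w"
  by (induction rule: schubert_rel.induct) (blast intro: longest_perm_perm_on perm_on_adj)+

lemma schubert_rel_cases:
  assumes "schubert_rel n w f"
  obtains "w = longest_perm n" "f = (\<Prod>i=1..n. xvar (int i) ^ (n - i))"
  | i g where "1 \<le> i" "i < int n" "w i < w (i + 1)" "schubert_rel n (w \<circ> adj i) g" "f = divdiff i g"
  using assms
proof (cases rule: schubert_rel.cases)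
  case (descent v g i)
  then show thesis by (intro that(2)[of i g]) simp_all
qed (use that in blast)

lemma schubert_rel_up:
  assumes "schubert_rel n (w \<circ> adj i) f" "1 \<le> i" "i < int n" "w i < w (i + 1)"
  shows "schubert_rel n w (divdiff i f)"
  using schubert_rel.descent[OF assms(1-3)] assms(4) by simp

text \<open>The recursion starts at the longest element, so inductions climb along ascents. By
  \<open>len_le\<close> the subtraction from \<open>n * n\<close> is not truncated, which makes it a
  decreasing measure.\<close>

lemma perm_on_len_up:
  assumes "perm_on n w" "1 \<le> i" "i < int n" "w i < w (i + 1)"
  shows "perm_on n (w \<circ> adj i)" "n * n - len (w \<circ> adj i) < n * n - len w"
proof -
  show p: "perm_on n (w \<circ> adj i)" using assms by (simp add: perm_on_adj)
  have "len (w \<circ> adj i) = Suc (len w)"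
    using len_adj[OF perm_on_S_Zpos[OF p], of i] assms(4) by simp
  then show "n * n - len (w \<circ> adj i) < n * n - len w" using len_le[OF p] by simp
qed

lemma schubert_rel_exists: "perm_on n w \<Longrightarrow> \<exists>f. schubert_rel n w f"
proof (induction "n * n - len w" arbitrary: w rule: less_induct)
  case less
  show ?case
  proof (cases "\<exists>i. 1 \<le> i \<and> i < int n \<and> w i < w (i + 1)")
    case True
    then obtain i where i: "1 \<le> i" "i < int n" "w i < w (i + 1)" by blast
    then show ?thesis
      using less(1)[OF perm_on_len_up(2,1)[OF less.prems i]] schubert_rel_up by blast
  next
    case False
    then have "w (i + 1) < w i" if "1 \<le> i" "i < int n" for i
      using that perm_on_inj[OF less.prems, of i "i + 1"] by force
    then have "w = longest_perm n" using no_ascent_longest_perm[OF less.prems] by blast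
    then show ?thesis using schubert_rel.longest by blast
  qed
qed

text \<open>Two ascents i and j of w can be completed inside the group generated by the two adjacent
  transpositions; the resulting polynomials agree by the commutation or the braid relation.\<close>

lemma schubert_rel_unique:
  "schubert_rel n w f \<Longrightarrow> schubert_rel n w g \<Longrightarrow> f = g"
proof (induction "n * n - len w" arbitrary: w f g rule: less_induct)
  case less
  have w: "perm_on n w" using less.prems(1) by (rule schubert_rel_perm_on)
  have IH: "f' = g'" if "1 \<le> i" "i < int n" "w i < w (i + 1)"
    "schubert_rel n (w \<circ> adj i) f'" "schubert_rel n (w \<circ> adj i) g'" for i f' g'
    using less.hyps[OF perm_on_len_up(2)[OF w that(1-3)] that(4,5)] .
  \<comment> \<open>Separates the two rules: a permutation reached by \<open>descent\<close> has an
    ascent, the longest one has none.\<close>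
  have no: "\<not> (longest_perm n i < longest_perm n (i + 1))" if "1 \<le> i" "i < int n" for i
    using that by (simp add: longest_perm_def)
  have far: "divdiff i f' = divdiff j g'"
    if i: "1 \<le> i" "i < int n" "w i < w (i + 1)" "schubert_rel n (w \<circ> adj i) f'"
    and j: "1 \<le> j" "j < int n" "w j < w (j + 1)" "schubert_rel n (w \<circ> adj j) g'"
    and ij: "i + 1 < j" for i j f' g'
  proof -
    have com: "w \<circ> adj j \<circ> adj i = w \<circ> adj i \<circ> adj j"
      using ij by (auto simp: fun_eq_iff transpose_def)
    have "perm_on n (w \<circ> adj i \<circ> adj j)"
      using w i j by (simp add: perm_on_adj)
    then obtain h where h: "schubert_rel n (w \<circ> adj i \<circ> adj j) h"
      using schubert_rel_exists by blast
    have "schubert_rel n (w \<circ> adj i) (divdiff j h)"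
      by (rule schubert_rel_up[OF h]) (use i j ij in \<open>auto simp: transpose_def\<close>)
    moreover have "schubert_rel n (w \<circ> adj j) (divdiff i h)"
      by (rule schubert_rel_up[of n _ i h]) (use h i j ij com in \<open>auto simp: transpose_def\<close>)
    ultimately have "f' = divdiff j h" "g' = divdiff i h" using IH i j by blast+
    then show ?thesis using ij divdiff_commute[of j i h] by simp
  qed
  have near: "divdiff i f' = divdiff (i + 1) g'"
    if i: "1 \<le> i" "i < int n" "w i < w (i + 1)" "schubert_rel n (w \<circ> adj i) f'"
    and j: "1 \<le> i + 1" "i + 1 < int n" "w (i + 1) < w (i + 1 + 1)" "schubert_rel n (w \<circ> adj (i + 1)) g'" for i f' g'
  proof -
    let ?j = "i + 1"
    have com: "w \<circ> adj i \<circ> adj ?j \<circ> adj i = w \<circ> adj ?j \<circ> adj i \<circ> adj ?j"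
      by (auto simp: fun_eq_iff transpose_def)
    have "perm_on n (w \<circ> adj i \<circ> adj ?j \<circ> adj i)"
      by (rule perm_on_adj[OF perm_on_adj[OF perm_on_adj[OF w i(1,2)] j(1,2)] i(1,2)])
    then obtain h where h: "schubert_rel n (w \<circ> adj i \<circ> adj ?j \<circ> adj i) h"
      using schubert_rel_exists by blast
    have ii: "i + 1 + 1 = i + 2" by simp
    have lt: "w i < w (i + 1)" "w (i + 1) < w (i + 2)" "w i < w (i + 2)" using i j by (auto simp: ii)
    have 1: "schubert_rel n (w \<circ> adj i \<circ> adj ?j) (divdiff i h)"
      by (rule schubert_rel_up[OF h]) (use i j lt in \<open>auto simp: transpose_def\<close>)
    have 2: "schubert_rel n (w \<circ> adj i) (divdiff ?j (divdiff i h))"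
      by (rule schubert_rel_up[OF 1]) (use i j lt in \<open>auto simp: transpose_def\<close>)
    have 3: "schubert_rel n (w \<circ> adj ?j \<circ> adj i) (divdiff ?j h)"
      by (rule schubert_rel_up[OF h[unfolded com]]) (use i j lt in \<open>auto simp: transpose_def\<close>)
    have 4: "schubert_rel n (w \<circ> adj ?j) (divdiff i (divdiff ?j h))"
      by (rule schubert_rel_up[OF 3]) (use i j lt in \<open>auto simp: transpose_def\<close>)
    have "f' = divdiff ?j (divdiff i h)" by (rule IH[OF i(1-4) 2])
    moreover have "g' = divdiff i (divdiff ?j h)" by (rule IH[OF j(1-4) 4])
    ultimately show ?thesis by (simp add: divdiff_braid)
  qed
  from less.prems(1) show ?case
  proof (cases rule: schubert_rel_cases)
    case 1
    from less.prems(2) show ?thesis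
      by (cases rule: schubert_rel_cases) (use 1 no in auto)
  next
    case (2 i f')
    from less.prems(2) show ?thesis
    proof (cases rule: schubert_rel_cases)
      case 1
      then show ?thesis using 2 no by auto
    next
      case (2 j g')
      note i = \<open>1 \<le> i\<close> \<open>i < int n\<close> \<open>w i < w (i + 1)\<close> \<open>schubert_rel n (w \<circ> adj i) f'\<close>
      note j = 2(1-4)
      consider "i = j" | "i + 1 < j" | "j + 1 < i" | "j = i + 1" | "i = j + 1" by linarith
      then show ?thesis
      proof cases
        case 1
        then show ?thesis using IH i j \<open>f = divdiff i f'\<close> \<open>g = divdiff j g'\<close> by blast
      next
        case 2
        then show ?thesis using far[OF i j] \<open>f = divdiff i f'\<close> \<open>g = divdiff j g'\<close> by simp
      next
        case 3
        then show ?thesis using far[OF j i] \<open>f = divdiff i f'\<close> \<open>g = divdiff j g'\<close> by simp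
      next
        case 4
        then show ?thesis using near[OF i] j \<open>f = divdiff i f'\<close> \<open>g = divdiff j g'\<close> by simp
      next
        case 5
        then show ?thesis using near[OF j] i \<open>f = divdiff i f'\<close> \<open>g = divdiff j g'\<close> by simp
      qed
    qed
  qed
qed

text \<open>The chain from the longest element of the larger group moves its largest value to the end.\<close>

lemma schubert_rel_longest_Suc:
  "schubert_rel (Suc n) (longest_perm n) (\<Prod>i=1..n. xvar (int i) ^ (n - i))"
proof -
  \<comment> \<open>\<open>p k\<close> is the member of the chain with the value
    \<open>n + 1\<close> at position \<open>k + 1\<close>; \<open>e k\<close> lists the exponents of
    its Schubert polynomial, which is a monomial.\<close>
  define p where "p k i = (if 1 \<le> i \<and> i \<le> int k then int n + 1 - i else if i = int k + 1 then int n + 1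
     else if int k + 1 < i \<and> i \<le> int n + 1 then int n + 2 - i else i)" for k :: nat and i :: int
  define e where "e k i = (if i \<le> k then n - i else n + 1 - i)" for k i :: nat
  have "schubert_rel (Suc n) (p k) (\<Prod>i=1..Suc n. xvar (int i) ^ e k i)" if "k \<le> n" for k
    using that
  proof (induction k)
    case 0
    have "p 0 = longest_perm (Suc n)" by (auto simp: p_def longest_perm_def)
    moreover have "(\<Prod>i=1..Suc n. xvar (int i) ^ e 0 i) = (\<Prod>i=1..Suc n. xvar (int i) ^ (Suc n - i))"
      by (intro prod.cong) (auto simp: e_def)
    ultimately show ?case using schubert_rel.longest[of "Suc n"] by (simp only:)
  next
    case (Suc k)
    let ?i = "int k + 1"
    have pk: "p k (?i + 1) < p k ?i" using Suc.prems by (simp add: p_def)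
    have psuc: "p k \<circ> adj ?i = p (Suc k)"
      using Suc.prems by (auto simp: fun_eq_iff p_def transpose_def)
    define A where "A = {1..Suc n} - {Suc k, Suc (Suc k)}"
    define r where "r = (\<Prod>i\<in>A. xvar (int i) ^ e k i)"
    define m where "m = n - Suc k"
    have split: "(\<Prod>i=1..Suc n. xvar (int i) ^ e k' i) =
       xvar (int (Suc k)) ^ e k' (Suc k) * (xvar (int (Suc (Suc k))) ^ e k' (Suc (Suc k)) * (\<Prod>i\<in>A. xvar (int i) ^ e k' i))" for k'
    proof -
      have "{1..Suc n} = insert (Suc k) (insert (Suc (Suc k)) A)" "finite A"
        "Suc k \<notin> insert (Suc (Suc k)) A" "Suc (Suc k) \<notin> A"
        using Suc.prems by (auto simp: A_def)
      then show ?thesis by simp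
    qed
    have r': "(\<Prod>i\<in>A. xvar (int i) ^ e (Suc k) i) = r"
      unfolding r_def by (intro prod.cong) (auto simp: A_def e_def)
    have ex: "e k (Suc k) = Suc m" "e k (Suc (Suc k)) = m" "e (Suc k) (Suc k) = m" "e (Suc k) (Suc (Suc k)) = m"
      using Suc.prems by (auto simp: e_def m_def)
    have ii: "int (Suc k) = ?i" "int (Suc (Suc k)) = ?i + 1" by simp_all
    \<comment> \<open>The two exponents differ by 1, so the monomial is an invariant part times
      \<open>xvar ?i\<close>, and the divided difference removes that last factor.\<close>
    have old: "(\<Prod>i=1..Suc n. xvar (int i) ^ e k i) = (xvar ?i * xvar (?i + 1)) ^ m * r * xvar ?i"
      unfolding split ex ii r_def[symmetric] by (simp add: power_mult_distrib algebra_simps)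
    have new: "(\<Prod>i=1..Suc n. xvar (int i) ^ e (Suc k) i) = (xvar ?i * xvar (?i + 1)) ^ m * r"
      unfolding split ex ii r' by (simp add: power_mult_distrib algebra_simps)
    have "indep ?i r" "indep (?i + 1) r"
      unfolding r_def by (auto intro!: indep_hom indep_var simp: A_def)
    then have "swap_vars ?i r = r" by (rule swap_indep)
    then have inv: "swap_vars ?i ((xvar ?i * xvar (?i + 1)) ^ m * r) = (xvar ?i * xvar (?i + 1)) ^ m * r"
      by (simp only: swap_hom swap_var_simps mult.commute)
    have "divdiff ?i (xvar ?i) = 1"
      using divdiff_var_power[of ?i 0] by simp
    then have "divdiff ?i (\<Prod>i=1..Suc n. xvar (int i) ^ e k i) = (\<Prod>i=1..Suc n. xvar (int i) ^ e (Suc k) i)"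
      unfolding old new divdiff_mult_invariant[OF inv] by simp
    then show ?case
      using schubert_rel.descent[OF Suc.IH, of ?i] Suc.prems pk psuc by simp
  qed
  from this[of n] have "schubert_rel (Suc n) (p n) (\<Prod>i=1..Suc n. xvar (int i) ^ e n i)" by simp
  moreover have "p n = longest_perm n" by (auto simp: fun_eq_iff p_def longest_perm_def)
  moreover have "(\<Prod>i=1..Suc n. xvar (int i) ^ e n i) = (\<Prod>i=1..n. xvar (int i) ^ (n - i))"
    by (simp add: e_def prod.atLeast_Suc_atMost)
  ultimately show ?thesis by simp
qed

lemma schubert_rel_Suc: "schubert_rel n w f \<Longrightarrow> schubert_rel (Suc n) w f"
proof (induction rule: schubert_rel.induct)
  case longest
  then show ?case by (rule schubert_rel_longest_Suc)
next
  case (descent w f i)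
  then show ?case by (intro schubert_rel.descent) auto
qed

lemma schubert_rel_mono:
  assumes "n \<le> m" "schubert_rel n w f"
  shows "schubert_rel m w f"
  using assms by (induction rule: dec_induct) (auto intro: schubert_rel_Suc)

section \<open>Divided differences and constant terms of Schubert polynomials\<close>

lemma schubert_eq: "schubert_rel n w f \<Longrightarrow> schubert w = f"
  unfolding schubert_def
proof (rule the_equality)
  fix g assume "schubert_rel n w f" "\<exists>n. schubert_rel n w g"
  then obtain m where "schubert_rel n w f" "schubert_rel m w g" by blast
  then have "schubert_rel (max n m) w f" "schubert_rel (max n m) w g"
    by (meson schubert_rel_mono max.cobounded1 max.cobounded2)+
  then show "g = f" by (rule schubert_rel_unique[symmetric])
qed blast

lemma schubert_rel_schubert: "perm_on n w \<Longrightarrow> schubert_rel n w (schubert w)"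
  using schubert_rel_exists schubert_eq by metis

lemma perm_on_large: "w \<in> S_Zpos \<Longrightarrow> \<exists>n. perm_on n w \<and> i < int n"
proof -
  assume "w \<in> S_Zpos"
  then obtain n where "perm_on n w" using S_Zpos_perm_on by blast
  then have "perm_on (n + nat i + 1) w" by (rule perm_on_mono) simp
  moreover have "i < int (n + nat i + 1)" by simp
  ultimately show ?thesis by blast
qed

lemma divdiff_schubert:
  assumes "w \<in> S_Zpos" "1 \<le> i" "w (i + 1) < w i"
  shows "divdiff i (schubert w) = schubert (w \<circ> adj i)"
proof -
  obtain n where n: "perm_on n w" "i < int n" using perm_on_large assms(1) by blast
  from schubert_rel.descent[OF schubert_rel_schubert[OF n(1)] assms(2) n(2) assms(3)]
  show ?thesis using schubert_eq by simp
qed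

text \<open>At an ascent \<open>schubert w\<close> is itself a value of \<open>divdiff i\<close>,
  and \<open>divdiff i\<close> squares to zero.\<close>

lemma divdiff_schubert_ascent:
  assumes "w \<in> S_Zpos" "1 \<le> i" "w i < w (i + 1)"
  shows "divdiff i (schubert w) = 0"
proof -
  have "divdiff i (schubert (w \<circ> adj i)) = schubert w"
    using divdiff_schubert[OF S_Zpos_adj[OF assms(1,2)] assms(2)] assms(3) by simp
  then show ?thesis by (metis divdiff_divdiff)
qed

lemma schubert_id [simp]: "schubert id = 1"
proof -
  have "longest_perm 1 = id" by (auto simp: longest_perm_def)
  moreover have "schubert_rel 1 (longest_perm 1) 1"
    using schubert_rel.longest[of 1] by simp
  ultimately show ?thesis using schubert_eq by metis
qed

lemma schubert_ident [simp]: "schubert (\<lambda>i. i) = 1"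
  using schubert_id by (simp add: id_def)

lemma len_induct [consumes 1, case_names step]:
  assumes "w \<in> S_Zpos"
    and "\<And>w. w \<in> S_Zpos \<Longrightarrow> (\<And>i. 1 \<le> i \<Longrightarrow> w (i + 1) < w i \<Longrightarrow> P (w \<circ> adj i)) \<Longrightarrow> P w"
  shows "P w"
  using assms(1)
proof (induction "len w" arbitrary: w rule: less_induct)
  case less
  show ?case
    by (rule assms(2)[OF less.prems]) (use less S_Zpos_adj len_adj in force)
qed

lemma schubert_neq_0: "w \<in> S_Zpos \<Longrightarrow> schubert w \<noteq> 0"
proof (induction rule: len_induct)
  case (step w)
  show ?case
  proof (cases "w = id")
    case False
    then obtain i where "1 \<le> i" "w (i + 1) < w i" using exists_descent step(1) by blast
    then show ?thesis by (metis divdiff_0 divdiff_schubert step)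
  qed simp
qed

lemma positive_vars_schubert_rel: "schubert_rel n w f \<Longrightarrow> positive_vars f"
proof (induction rule: schubert_rel.induct)
  case longest
  then show ?case by (auto simp: positive_vars_def intro!: indep_hom indep_var)
next
  case (descent w f i)
  then show ?case by (auto simp: positive_vars_def intro!: indep_divdiff)
qed

lemma positive_vars_schubert: "w \<in> S_Zpos \<Longrightarrow> positive_vars (schubert w)"
  using S_Zpos_perm_on schubert_rel_schubert positive_vars_schubert_rel by blast

text \<open>Homogeneity is expressed by the substitution \<open>x\<^sub>i \<mapsto> x\<^sub>0 x\<^sub>i\<close>, where \<open>x\<^sub>0\<close> is a variable that does not
  occur in Schubert polynomials.\<close>

lemma homogeneous_schubert_rel:
  "schubert_rel n w f \<Longrightarrow> \<exists>d. subst (\<lambda>i. xvar 0 * xvar i) f = xvar 0 ^ d * f"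
proof (induction rule: schubert_rel.induct)
  case longest
  then show ?case
    by (simp add: cp.psub_hom power_mult_distrib prod.distrib power_sum[symmetric]) blast
next
  case (descent w f i)
  let ?\<tau> = "\<lambda>i. xvar 0 * xvar i"
  obtain d where d: "subst ?\<tau> f = xvar 0 ^ d * f" using descent.IH by blast
  have "swap_vars i (subst ?\<tau> f) = subst ?\<tau> (swap_vars i f)"
    unfolding subst_swap swap_subst using \<open>1 \<le> i\<close>
    by (intro arg_cong[where f="\<lambda>\<phi>. subst \<phi> f"]) (auto simp: fun_eq_iff swap_hom swap_var)
  then have "subst ?\<tau> (swap_vars i f) = xvar 0 ^ d * swap_vars i f"
    using d \<open>1 \<le> i\<close> by (simp add: swap_hom)
  then have "(xvar 0 * xvar i - xvar 0 * xvar (i + 1)) * subst ?\<tau> (divdiff i f) = xvar 0 ^ d * (f - swap_vars i f)"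
    unfolding subst_divdiff[of ?\<tau>] by (simp add: d right_diff_distrib)
  then have "(xvar i - xvar (i + 1)) * (xvar 0 * subst ?\<tau> (divdiff i f)) = (xvar i - xvar (i + 1)) * (xvar 0 ^ d * divdiff i f)"
    unfolding divdiff_eq[symmetric] by (simp add: algebra_simps)
  then have eq: "xvar 0 * subst ?\<tau> (divdiff i f) = xvar 0 ^ d * divdiff i f"
    by simp
  show ?case
  proof (cases d)
    \<comment> \<open>The degree would become negative: setting \<open>xvar 0\<close>, which is
      absent from \<open>divdiff i f\<close>, to zero shows that the divided difference
      vanishes.\<close>
    case 0
    have "positive_vars (divdiff i f)"
      using positive_vars_schubert_rel[OF schubert_rel.descent[OF descent.hyps]] .
    then have "indep 0 (divdiff i f)" by (simp add: positive_vars_def)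
    then have "divdiff i f = subst (xvar(0 := 0)) (xvar 0 * subst ?\<tau> (divdiff i f))"
      unfolding eq by (simp add: 0 indep_def)
    then have "divdiff i f = 0" by (simp add: cp.psub_hom)
    then show ?thesis by simp
  next
    case (Suc e)
    then have "xvar 0 * subst ?\<tau> (divdiff i f) = xvar 0 * (xvar 0 ^ e * divdiff i f)"
      using eq by (simp add: mult.assoc)
    then show ?thesis by auto
  qed
qed

text \<open>Setting \<open>xvar 0\<close> to zero in the homogeneity equation leaves
  \<open>0 ^ d * schubert w\<close>. Degree 0 is impossible, since a descent of \<open>w\<close>
  gives a nonzero divided difference.\<close>

lemma ct_schubert: "w \<in> S_Zpos \<Longrightarrow> w \<noteq> id \<Longrightarrow> ct (schubert w) = 0"
proof -
  assume w: "w \<in> S_Zpos" "w \<noteq> id"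
  obtain d where d: "subst (\<lambda>i. xvar 0 * xvar i) (schubert w) = xvar 0 ^ d * schubert w"
    using homogeneous_schubert_rel S_Zpos_perm_on[OF w(1)] schubert_rel_schubert by blast
  have "subst (xvar(0 := 0)) (subst (\<lambda>i. xvar 0 * xvar i) (schubert w)) = ct (schubert w)"
    by (simp add: subst_subst cp.psub_hom)
  then have ct: "ct (schubert w) = 0 ^ d * schubert w"
    using positive_vars_schubert[OF w(1)] unfolding d
    by (simp add: cp.psub_hom positive_vars_def indep_def)
  obtain i where i: "1 \<le> i" "w (i + 1) < w i" using exists_descent w by blast
  have "d \<noteq> 0"
  proof
    assume "d = 0"
    then obtain a where "schubert w = cpoly a" using ct ct_const[of "schubert w"] by auto
    then have "divdiff i (schubert w) = 0" by simp
    then show False using divdiff_schubert[OF w(1) i] schubert_neq_0 S_Zpos_adj[OF w(1) i(1)] by simp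
  qed
  then show ?thesis using ct by simp
qed

section \<open>Setting the first variable to zero\<close>

definition unshift :: "(int \<Rightarrow> int) \<Rightarrow> int \<Rightarrow> int" where
  "unshift w = (\<lambda>i. w (i + 1) - 1)"

lemma gshift_unshift [simp]: "gshift (unshift w) = w"
  and unshift_gshift [simp]: "unshift (gshift w) = w"
  by (auto simp: gshift_def unshift_def)

lemma gshift_S_Z: "w \<in> S_Z \<Longrightarrow> gshift w \<in> S_Z"
proof -
  assume w: "w \<in> S_Z"
  have "gshift w = (\<lambda>i. i + 1) \<circ> w \<circ> (\<lambda>i. i - 1)" by (auto simp: gshift_def)
  moreover have "bij (\<lambda>i::int. i + 1)" by (rule bij_betw_byWitness[where f'="\<lambda>i. i - 1"]) auto
  moreover have "bij (\<lambda>i::int. i - 1)" by (rule bij_betw_byWitness[where f'="\<lambda>i. i + 1"]) auto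
  ultimately have "bij (gshift w)" using w by (auto simp: S_Z_def intro!: bij_comp)
  moreover have "{i. gshift w i \<noteq> i} \<subseteq> (\<lambda>i. i + 1) ` {i. w i \<noteq> i}"
  proof
    fix i assume "i \<in> {i. gshift w i \<noteq> i}"
    then have "i - 1 \<in> {i. w i \<noteq> i}" by (auto simp: gshift_def)
    then have "i - 1 + 1 \<in> (\<lambda>i. i + 1) ` {i. w i \<noteq> i}" by (rule imageI)
    then show "i \<in> (\<lambda>i. i + 1) ` {i. w i \<noteq> i}" by simp
  qed
  then have "finite {i. gshift w i \<noteq> i}" using w by (auto simp: S_Z_def intro: finite_subset)
  ultimately show ?thesis by (simp add: S_Z_def)
qed

lemma unshift_S_Z: "w \<in> S_Z \<Longrightarrow> unshift w \<in> S_Z"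
proof -
  assume w: "w \<in> S_Z"
  have "unshift w = (\<lambda>i. i - 1) \<circ> w \<circ> (\<lambda>i. i + 1)" by (auto simp: unshift_def)
  moreover have "bij (\<lambda>i::int. i + 1)" by (rule bij_betw_byWitness[where f'="\<lambda>i. i - 1"]) auto
  moreover have "bij (\<lambda>i::int. i - 1)" by (rule bij_betw_byWitness[where f'="\<lambda>i. i + 1"]) auto
  ultimately have "bij (unshift w)" using w by (auto simp: S_Z_def intro!: bij_comp)
  moreover have "{i. unshift w i \<noteq> i} \<subseteq> (\<lambda>i. i - 1) ` {i. w i \<noteq> i}"
  proof
    fix i assume "i \<in> {i. unshift w i \<noteq> i}"
    then have "i + 1 \<in> {i. w i \<noteq> i}" by (auto simp: unshift_def)
    then have "i + 1 - 1 \<in> (\<lambda>i. i - 1) ` {i. w i \<noteq> i}" by (rule imageI)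
    then show "i \<in> (\<lambda>i. i - 1) ` {i. w i \<noteq> i}" by simp
  qed
  then have "finite {i. unshift w i \<noteq> i}" using w by (auto simp: S_Z_def intro: finite_subset)
  ultimately show ?thesis by (simp add: S_Z_def)
qed

lemma gshift_S_Zpos: "w \<in> S_Zpos \<Longrightarrow> gshift w \<in> S_Zpos"
  and gshift_1: "w \<in> S_Zpos \<Longrightarrow> gshift w 1 = 1"
  by (auto simp: S_Zpos_def gshift_S_Z) (auto simp: gshift_def)

lemma unshift_S_Zpos: "w \<in> S_Zpos \<Longrightarrow> w 1 = 1 \<Longrightarrow> unshift w \<in> S_Zpos"
proof -
  assume w: "w \<in> S_Zpos" "w 1 = 1"
  have "w (i + 1) = i + 1" if "i \<le> 0" for i
    using w that by (cases "i = 0") (auto simp: S_Zpos_def)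
  then show ?thesis using w by (auto simp: S_Zpos_def unshift_S_Z) (simp add: unshift_def)
qed

lemma unshift_adj: "unshift w \<circ> adj i = unshift (w \<circ> adj (i + 1))"
  by (auto simp: unshift_def transpose_def fun_eq_iff)

text \<open>Indices below 1 are sent to zero as well, so that the image satisfies
  \<open>positive_vars\<close> for every argument.\<close>

definition drop1 :: "rpoly \<Rightarrow> rpoly" where
  "drop1 = subst (\<lambda>i. if i \<le> 1 then 0 else xvar (i - 1))"

lemma drop1_hom: "drop1 (f + g) = drop1 f + drop1 g" "drop1 (f * g) = drop1 f * drop1 g"
  "drop1 (sum F A) = (\<Sum>x\<in>A. drop1 (F x))" "drop1 (cpoly a) = cpoly a" "drop1 0 = 0" "drop1 1 = 1"
  by (simp_all add: drop1_def cp.psub_hom)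

lemma drop1_eq_0: "subst (xvar(1 := 0)) f = 0 \<Longrightarrow> drop1 f = 0"
proof -
  assume "subst (xvar(1 := 0)) f = 0"
  then have "drop1 (subst (xvar(1 := 0)) f) = 0" by (simp add: drop1_hom)
  moreover have "drop1 (subst (xvar(1 := 0)) f) = drop1 f"
    unfolding drop1_def subst_subst by (rule arg_cong[where f="\<lambda>\<phi>. subst \<phi> f"]) auto
  ultimately show ?thesis by simp
qed

lemma divdiff_drop1:
  assumes "1 \<le> i"
  shows "divdiff i (drop1 f) = drop1 (divdiff (i + 1) f)"
proof (rule divdiff_unique)
  have "drop1 (swap_vars (i + 1) f) = swap_vars i (drop1 f)"
    unfolding drop1_def subst_swap swap_subst using assms
    by (intro arg_cong[where f="\<lambda>\<phi>. subst \<phi> f"]) (auto simp: fun_eq_iff swap_var transpose_def)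
  then show "(xvar i - xvar (i + 1)) * drop1 (divdiff (i + 1) f) = drop1 f - swap_vars i (drop1 f)"
    using subst_divdiff[of "\<lambda>i. if i \<le> 1 then 0 else xvar (i - 1)" "i + 1" f] assms
    by (simp add: drop1_def add.commute)
qed

lemma ct_drop1: "ct (drop1 f) = ct f"
  unfolding drop1_def subst_subst by (rule arg_cong[where f="\<lambda>\<phi>. subst \<phi> f"]) (auto simp: fun_eq_iff)

lemma positive_vars_drop1: "positive_vars (drop1 f)"
  unfolding positive_vars_def indep_def drop1_def subst_subst
  by (intro allI impI arg_cong[where f="\<lambda>\<phi>. subst \<phi> f"]) (auto simp: fun_eq_iff)

lemma positive_vars_0 [simp]: "positive_vars 0"
  by (simp add: positive_vars_def)

text \<open>By \<open>divdiff_ct_determine\<close> it suffices to compare divided differences and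
  constant terms. \<open>divdiff i\<close> after \<open>drop1\<close> is
  \<open>divdiff (i + 1)\<close> before it, which leaves position 1 untouched, so induction on
  length applies.\<close>

lemma drop1_schubert:
  "w \<in> S_Zpos \<Longrightarrow> drop1 (schubert w) = (if w 1 = 1 then schubert (unshift w) else 0)"
proof (induction rule: len_induct)
  case (step w)
  show ?case
  proof (cases "w = id")
    case True
    have "unshift (\<lambda>i. i) = (\<lambda>i. i)" by (auto simp: unshift_def)
    then show ?thesis using True by (simp add: drop1_hom id_def)
  next
    case False
    have dd: "divdiff i (drop1 (schubert w)) =
        (if w (i + 2) < w (i + 1) then if w 1 = 1 then schubert (unshift (w \<circ> adj (i + 1))) else 0 else 0)"
      if "i \<ge> 1" for i
    proof -
      have i2: "i + 1 + 1 = i + 2" by simp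
      show ?thesis
      proof (cases "w (i + 2) < w (i + 1)")
        case True
        have IH: "drop1 (schubert (w \<circ> adj (i + 1))) =
            (if (w \<circ> adj (i + 1)) 1 = 1 then schubert (unshift (w \<circ> adj (i + 1))) else 0)"
          by (rule step.IH) (use True that in \<open>simp_all add: i2\<close>)
        have e: "(w \<circ> adj (i + 1)) 1 = w 1" using that by simp
        have "divdiff i (drop1 (schubert w)) = drop1 (schubert (w \<circ> adj (i + 1)))"
          using that True divdiff_schubert[OF step(1), of "i + 1"] by (simp add: divdiff_drop1 i2)
        then show ?thesis using True by (simp only: IH e if_True)
      next
        case False
        then have "w (i + 1) < w (i + 2)" using S_Zpos_inj[OF step(1), of "i + 1" "i + 2"] by force
        then show ?thesis using that False divdiff_schubert_ascent[OF step(1), of "i + 1"]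
          by (simp add: divdiff_drop1 i2 drop1_hom)
      qed
    qed
    have ct0: "ct (drop1 (schubert w)) = 0" using ct_drop1 ct_schubert step(1) False by simp
    show ?thesis
    proof (cases "w 1 = 1")
      case True
      have uw: "unshift w \<in> S_Zpos" using unshift_S_Zpos step(1) True by blast
      have "unshift w \<noteq> id"
      proof
        assume "unshift w = id"
        then have "w = gshift id" by (metis gshift_unshift)
        then show False using False by (auto simp: gshift_def)
      qed
      then have ct1: "ct (schubert (unshift w)) = 0" using ct_schubert uw by blast
      have eqd: "divdiff i (schubert (unshift w)) = divdiff i (drop1 (schubert w))" if "i \<ge> 1" for i
      proof (cases "w (i + 2) < w (i + 1)")
        case lt: True
        then have "unshift w (i + 1) < unshift w i" by (simp add: unshift_def add.assoc)
        then show ?thesis using dd[OF that] lt True divdiff_schubert[OF uw that] by (simp add: unshift_adj)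
      next
        case nlt: False
        then have "w (i + 1) < w (i + 2)" using S_Zpos_inj[OF step(1), of "i + 1" "i + 2"] by force
        then have "unshift w i < unshift w (i + 1)" by (simp add: unshift_def add.assoc)
        then show ?thesis using dd[OF that] nlt divdiff_schubert_ascent[OF uw that] by simp
      qed
      have "drop1 (schubert w) = schubert (unshift w)"
      proof (rule divdiff_ct_determine[OF positive_vars_drop1 positive_vars_schubert[OF uw]])
        show "divdiff i (drop1 (schubert w)) = divdiff i (schubert (unshift w))" if "i \<ge> 1" for i
          by (rule eqd[OF that, symmetric])
        show "ct (drop1 (schubert w)) = ct (schubert (unshift w))" unfolding ct0 ct1 ..
      qed
      then show ?thesis using True by simp
    next
      case w1: False
      have "drop1 (schubert w) = 0"
        by (rule divdiff_ct_determine[OF positive_vars_drop1]) (use ct0 dd w1 in auto)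
      then show ?thesis using w1 by simp
    qed
  qed
qed

section \<open>Expansions in Schubert polynomials\<close>

text \<open>The condition under the definite description in \<open>schubert_const\<close>, for an
  arbitrary polynomial in place of a product.\<close>

definition expands :: "((int \<Rightarrow> int) \<Rightarrow> rat) \<Rightarrow> rpoly \<Rightarrow> bool" where
  "expands c f \<longleftrightarrow> finite {z. c z \<noteq> 0} \<and> {z. c z \<noteq> 0} \<subseteq> S_Zpos \<and>
     f = (\<Sum>z | c z \<noteq> 0. cpoly (c z) * schubert z)"

lemma sum_support:
  assumes "finite A" "{z. c z \<noteq> 0} \<subseteq> A"
  shows "(\<Sum>z | c z \<noteq> 0. cpoly (c z) * F z) = (\<Sum>z\<in>A. cpoly (c z) * F z)"
  by (rule sum.mono_neutral_left) (use assms in auto)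

lemma expandsI:
  assumes "finite A" "{z. c z \<noteq> 0} \<subseteq> A" "A \<subseteq> S_Zpos" "f = (\<Sum>z\<in>A. cpoly (c z) * schubert z)"
  shows "expands c f"
  unfolding expands_def using assms sum_support[OF assms(1,2), of schubert]
  by (auto intro: finite_subset)

lemma expands_0: "expands (\<lambda>_. 0) 0"
  by (simp add: expands_def)

lemma expands_schubert: "w \<in> S_Zpos \<Longrightarrow> expands (\<lambda>z. if z = w then 1 else 0) (schubert w)"
  by (rule expandsI[of "{w}"]) auto

lemma expands_add:
  assumes "expands c f" "expands d g"
  shows "expands (\<lambda>z. c z + d z) (f + g)"
proof -
  let ?A = "{z. c z \<noteq> 0} \<union> {z. d z \<noteq> 0}"
  have A: "finite ?A" "?A \<subseteq> S_Zpos" using assms by (auto simp: expands_def)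
  have "f = (\<Sum>z\<in>?A. cpoly (c z) * schubert z)" "g = (\<Sum>z\<in>?A. cpoly (d z) * schubert z)"
    using assms sum_support[OF A(1), of _ schubert] by (auto simp: expands_def)
  then show ?thesis
    by (intro expandsI[OF A(1) _ A(2)]) (auto simp: cpoly_add ring_distribs sum.distrib)
qed

lemma expands_cmult:
  assumes "expands c f"
  shows "expands (\<lambda>z. a * c z) (cpoly a * f)"
  by (rule expandsI[of "{z. c z \<noteq> 0}"])
     (use assms in \<open>auto simp: expands_def sum_distrib_left cpoly_mult mult.assoc\<close>)

lemma expands_diff:
  assumes "expands c f" "expands d g"
  shows "expands (\<lambda>z. c z - d z) (f - g)"
  using expands_add[OF assms(1) expands_cmult[OF assms(2), of "-1"]] by (simp add: cpoly_uminus)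

text \<open>Terms with an ascent at \<open>i\<close> die; on those with a descent the map to
  \<open>z \<circ> adj i\<close> is injective, so no coefficients merge.\<close>

lemma expands_divdiff:
  assumes "expands c f" "1 \<le> i"
  shows "expands (\<lambda>y. if y i < y (i + 1) then c (y \<circ> adj i) else 0) (divdiff i f)"
proof -
  define A where "A = {z. c z \<noteq> 0}"
  have A: "finite A" "A \<subseteq> S_Zpos" "f = (\<Sum>z\<in>A. cpoly (c z) * schubert z)"
    using assms by (auto simp: expands_def A_def)
  define D where "D = {z \<in> A. z (i + 1) < z i}"
  define c' where "c' y = (if y i < y (i + 1) then c (y \<circ> adj i) else 0)" for y
  have inj: "inj_on (\<lambda>z. z \<circ> adj i) D" by (metis comp_adj_adj inj_onI)
  have "divdiff i f = (\<Sum>z\<in>A. cpoly (c z) * divdiff i (schubert z))"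
    by (simp add: A(3) divdiff_sum divdiff_cmult)
  also have "\<dots> = (\<Sum>z\<in>D. cpoly (c z) * divdiff i (schubert z))"
  proof (rule sum.mono_neutral_right)
    show "\<forall>z\<in>A - D. cpoly (c z) * divdiff i (schubert z) = 0"
    proof
      fix z assume z: "z \<in> A - D"
      then have "z i < z (i + 1)"
        using S_Zpos_inj[of z i "i + 1"] A(2) by (force simp: D_def)
      then show "cpoly (c z) * divdiff i (schubert z) = 0"
        using z A(2) assms(2) by (simp add: divdiff_schubert_ascent subset_iff)
    qed
  qed (auto simp: D_def A(1))
  also have "\<dots> = (\<Sum>z\<in>D. cpoly (c' (z \<circ> adj i)) * schubert (z \<circ> adj i))"
    using A(2) assms(2) by (intro sum.cong) (auto simp: D_def c'_def divdiff_schubert)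
  also have "\<dots> = (\<Sum>y\<in>(\<lambda>z. z \<circ> adj i) ` D. cpoly (c' y) * schubert y)"
    by (simp add: sum.reindex[OF inj])
  finally have eq: "divdiff i f = (\<Sum>y\<in>(\<lambda>z. z \<circ> adj i) ` D. cpoly (c' y) * schubert y)" .
  have "expands c' (divdiff i f)"
  proof (rule expandsI[OF _ _ _ eq])
    show "finite ((\<lambda>z. z \<circ> adj i) ` D)" using A(1) by (simp add: D_def)
    show "(\<lambda>z. z \<circ> adj i) ` D \<subseteq> S_Zpos"
      using A(2) assms(2) by (auto simp: D_def intro!: S_Zpos_adj)
    show "{z. c' z \<noteq> 0} \<subseteq> (\<lambda>z. z \<circ> adj i) ` D"
    proof
      fix y assume "y \<in> {z. c' z \<noteq> 0}"
      then have y: "y i < y (i + 1)" "c (y \<circ> adj i) \<noteq> 0" by (auto simp: c'_def split: if_splits)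
      then have "y \<circ> adj i \<in> D" by (simp add: D_def A_def)
      moreover have "y = y \<circ> adj i \<circ> adj i" by simp
      ultimately show "y \<in> (\<lambda>z. z \<circ> adj i) ` D" by blast
    qed
  qed
  then show ?thesis by (simp add: c'_def[abs_def])
qed

lemma expands_drop1:
  assumes "expands c f"
  shows "expands (\<lambda>y. if y \<in> S_Zpos then c (gshift y) else 0) (drop1 f)"
proof -
  define A where "A = {z. c z \<noteq> 0}"
  have A: "finite A" "A \<subseteq> S_Zpos" "f = (\<Sum>z\<in>A. cpoly (c z) * schubert z)"
    using assms by (auto simp: expands_def A_def)
  define D where "D = {z \<in> A. z 1 = 1}"
  define c' where "c' y = (if y \<in> S_Zpos then c (gshift y) else 0)" for y
  have "drop1 f = (\<Sum>z\<in>A. cpoly (c z) * drop1 (schubert z))"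
    by (simp add: A(3) drop1_hom)
  also have "\<dots> = (\<Sum>z\<in>D. cpoly (c z) * drop1 (schubert z))"
  proof (rule sum.mono_neutral_right)
    have "drop1 (schubert z) = 0" if "z \<in> A - D" for z
      using that A(2) drop1_schubert[of z] by (auto simp: D_def)
    then show "\<forall>z\<in>A - D. cpoly (c z) * drop1 (schubert z) = 0" by simp
  qed (auto simp: D_def A(1))
  also have "\<dots> = (\<Sum>z\<in>D. cpoly (c' (unshift z)) * schubert (unshift z))"
    using A(2) by (intro sum.cong) (auto simp: D_def c'_def drop1_schubert unshift_S_Zpos)
  also have "\<dots> = (\<Sum>y\<in>unshift ` D. cpoly (c' y) * schubert y)"
    by (rule sum.reindex[symmetric, unfolded comp_def]) (metis gshift_unshift inj_onI)
  finally have eq: "drop1 f = (\<Sum>y\<in>unshift ` D. cpoly (c' y) * schubert y)" .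
  have "expands c' (drop1 f)"
  proof (rule expandsI[OF _ _ _ eq])
    show "finite (unshift ` D)" using A(1) by (simp add: D_def)
    show "unshift ` D \<subseteq> S_Zpos"
      using A(2) by (auto simp: D_def intro!: unshift_S_Zpos)
    show "{z. c' z \<noteq> 0} \<subseteq> unshift ` D"
    proof
      fix y assume "y \<in> {z. c' z \<noteq> 0}"
      then have y: "y \<in> S_Zpos" "c (gshift y) \<noteq> 0" by (auto simp: c'_def split: if_splits)
      then have "gshift y \<in> D" by (simp add: D_def A_def gshift_1)
      moreover have "y = unshift (gshift y)" by simp
      ultimately show "y \<in> unshift ` D" by blast
    qed
  qed
  then show ?thesis by (simp add: c'_def[abs_def])
qed

text \<open>Linear independence, by induction on a bound for the lengths. A term other than
  \<open>id\<close> has a descent, and the divided difference there gives a relation among shorter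
  permutations that still has a nonzero coefficient.\<close>

lemma expands_0_imp_0:
  assumes "expands c 0"
  shows "c z = 0"
proof -
  have "\<forall>z. c z = 0" if "expands c 0" "\<And>z. c z \<noteq> 0 \<Longrightarrow> len z \<le> L" for c L
    using that
  proof (induction L arbitrary: c rule: less_induct)
    case (less L)
    have S: "z \<in> S_Zpos" if "c z \<noteq> 0" for z using less.prems(1) that by (auto simp: expands_def)
    have "z = id" if z: "c z \<noteq> 0" for z
    proof (rule ccontr)
      assume "z \<noteq> id"
      then obtain i where i: "i \<ge> 1" "z (i + 1) < z i" using exists_descent S[OF z] by blast
      define c' where "c' y = (if y i < y (i + 1) then c (y \<circ> adj i) else 0)" for y
      have c': "expands c' 0" using expands_divdiff[OF less.prems(1) i(1)] by (simp add: c'_def[abs_def])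
      have len: "len z = Suc (len (z \<circ> adj i))" using len_adj[OF S[OF z] i(2)] .
      have nz: "c' (z \<circ> adj i) \<noteq> 0" using z i by (simp add: c'_def)
      have "len y \<le> L - 1" if "c' y \<noteq> 0" for y
      proof -
        have y: "y i < y (i + 1)" "c (y \<circ> adj i) \<noteq> 0" using that by (auto simp: c'_def split: if_splits)
        then have "len (y \<circ> adj i) = Suc (len y)"
          using len_adj[OF S[OF y(2)], of i] by simp
        then show ?thesis using less.prems(2)[OF y(2)] by (simp add: comp_def)
      qed
      moreover have "L - 1 < L" using less.prems(2)[OF z] len by simp
      ultimately show False using less.IH[of "L - 1" c'] c' nz by blast
    qed
    then have "{z. c z \<noteq> 0} \<subseteq> {id}" by blast
    from sum_support[OF _ this, of schubert] have "cpoly (c id) = 0"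
      using less.prems(1) by (simp add: expands_def)
    then show ?case using \<open>{z. c z \<noteq> 0} \<subseteq> {id}\<close> by auto
  qed
  moreover have "len y \<le> Max (len ` {z. c z \<noteq> 0})" if "c y \<noteq> 0" for y
    using assms that by (intro Max_ge) (auto simp: expands_def)
  ultimately show ?thesis using assms by blast
qed

lemma expands_unique: "expands c f \<Longrightarrow> expands d f \<Longrightarrow> c = d"
  using expands_0_imp_0[of "\<lambda>z. c z - d z"] expands_diff[of c f d f] by auto

section \<open>Leading coefficients of Schubert polynomials\<close>

text \<open>No descents from position \<open>N\<close> on. For \<open>w\<close> in
  \<open>S_Zpos\<close> and \<open>N \<ge> 1\<close>, \<open>schubert w\<close> then involves only
  variables of index below \<open>N\<close>.\<close>

definition incr :: "int \<Rightarrow> (int \<Rightarrow> int) \<Rightarrow> bool" where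
  "incr N w \<longleftrightarrow> (\<forall>i\<ge>N. w i < w (i + 1))"

lemma incr_mono: "incr N w \<Longrightarrow> N \<le> M \<Longrightarrow> incr M w"
  by (auto simp: incr_def)

lemma incr_less: "incr N w \<Longrightarrow> N \<le> a \<Longrightarrow> a < b \<Longrightarrow> w a < w b"
  using increasing_ge[of a w b] by (auto simp: incr_def)

lemma incr_extend: "incr (N + 1) w \<Longrightarrow> w N < w (N + 1) \<Longrightarrow> incr N w"
  unfolding incr_def
proof (intro allI impI)
  fix i assume "\<forall>i\<ge>N + 1. w i < w (i + 1)" "w N < w (N + 1)" "N \<le> i"
  then show "w i < w (i + 1)" by (cases "i = N") auto
qed

text \<open>Permutations that agree before \<open>M\<close> have the same set of values from
  \<open>M\<close> on.\<close>

lemma tail_value: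
  assumes "w \<in> S_Zpos" "v \<in> S_Zpos" "\<And>i. i < M \<Longrightarrow> v i = w i" "M \<le> j"
  shows "\<exists>k\<ge>M. v j = w k"
proof -
  have "surj w" using assms(1) by (auto simp: S_Zpos_def S_Z_def bij_def)
  then obtain k where k: "v j = w k" by (metis surjD)
  have "k \<ge> M"
  proof (rule ccontr)
    assume "\<not> k \<ge> M"
    then have "v k = v j" using assms(3)[of k] k by simp
    then show False using S_Zpos_inj[OF assms(2)] \<open>\<not> k \<ge> M\<close> assms(4) by auto
  qed
  then show ?thesis using k by blast
qed

text \<open>The entry at \<open>N\<close> moves right past the smaller later ones, at the cost of
  one divided difference per exchange; \<open>d\<close> counts them. A further operator meets an
  ascent and gives 0.\<close>

lemma sort_tail:
  assumes "w \<in> S_Zpos" "1 \<le> N" "incr (N + 1) w"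
  shows "\<exists>d v. v \<in> S_Zpos \<and> incr N v \<and> (\<forall>i<N. v i = w i) \<and>
    divdiffs_up d N (schubert w) = schubert v \<and> (\<forall>e>d. divdiffs_up e N (schubert w) = 0)"
  using assms
proof (induction w arbitrary: N rule: len_induct)
  case (step w)
  show ?case
  proof (cases "w N < w (N + 1)")
    case True
    then have "incr N w" by (rule incr_extend[OF step.prems(2)])
    moreover have "divdiffs_up e N (schubert w) = 0" if "e > 0" for e
      using that divdiff_schubert_ascent[OF step(1) step.prems(1) True] by (cases e) auto
    ultimately show ?thesis using step(1) by (intro exI[of _ 0] exI[of _ w]) auto
  next
    case False
    then have desc: "w (N + 1) < w N" using S_Zpos_inj[OF step(1), of N "N + 1"] by force
    let ?w = "w \<circ> adj N"
    have S: "?w \<in> S_Zpos" using S_Zpos_adj step by blast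
    have inc: "incr (N + 1 + 1) ?w"
      using step.prems(2) by (auto simp: incr_def transpose_def)
    have "\<exists>d v. v \<in> S_Zpos \<and> incr (N + 1) v \<and> (\<forall>i<N + 1. v i = ?w i) \<and>
      divdiffs_up d (N + 1) (schubert ?w) = schubert v \<and> (\<forall>e>d. divdiffs_up e (N + 1) (schubert ?w) = 0)"
    proof (rule step.IH[OF step.prems(1) desc])
      show "1 \<le> N + 1" using step.prems(1) by simp
      show "incr (N + 1 + 1) ?w" by (rule inc)
    qed
    then obtain d v where v: "v \<in> S_Zpos" "incr (N + 1) v" "\<And>i. i < N + 1 \<Longrightarrow> v i = ?w i"
      "divdiffs_up d (N + 1) (schubert ?w) = schubert v" "\<forall>e>d. divdiffs_up e (N + 1) (schubert ?w) = 0"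
      by blast
    have vN: "v N = w (N + 1)" using v(3)[of N] by simp
    obtain k where k: "k \<ge> N + 1" "v (N + 1) = ?w k"
      using tail_value[OF S v(1), of "N + 1" "N + 1"] v(3) by blast
    \<comment> \<open>\<open>w (N + 1)\<close> is the least value from \<open>N\<close> on: it is
      below \<open>w N\<close> by the descent and below the later ones by
      \<open>incr\<close>.\<close>
    have "w (N + 1) < ?w k"
    proof (cases "k = N + 1")
      case True
      then show ?thesis using desc by simp
    next
      case False
      then show ?thesis using k(1) incr_less[OF step.prems(2), of "N + 1" k] by simp
    qed
    then have "v N < v (N + 1)" using vN k by simp
    then have "incr N v" by (rule incr_extend[OF v(2)])
    moreover have "v i = w i" if "i < N" for i using v(3)[of i] that by simp
    moreover have dd: "divdiff N (schubert w) = schubert ?w"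
      using divdiff_schubert[OF step(1) step.prems(1) desc] .
    moreover have "divdiffs_up e N (schubert w) = 0" if "e > Suc d" for e
      using that dd v(5) by (cases e) auto
    ultimately show ?thesis using v by (intro exI[of _ "Suc d"] exI[of _ v]) auto
  qed
qed

text \<open>Reverses \<open>sort_tail\<close> for any prescribed \<open>d\<close>: the entry
  \<open>w (N + d)\<close> is rotated to position \<open>N\<close>.\<close>

lemma unsort_tail:
  assumes "w \<in> S_Zpos" "1 \<le> N" "incr N w"
  shows "\<exists>v. v \<in> S_Zpos \<and> incr (N + 1) v \<and> (\<forall>i<N. v i = w i) \<and>
    divdiffs_up d N (schubert v) = schubert w \<and> (\<forall>e>d. divdiffs_up e N (schubert v) = 0)"
  using assms(2,3)
proof (induction d arbitrary: N)
  case 0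
  have "divdiffs_up e N (schubert w) = 0" if "e > 0" for e
    using that divdiff_schubert_ascent[OF assms(1) 0(1)] 0(2) by (cases e) (auto simp: incr_def)
  then show ?case using assms(1) 0 incr_mono[of N w "N + 1"] by (intro exI[of _ w]) auto
next
  case (Suc d)
  have "incr (N + 1) w" using Suc.prems incr_mono by auto
  then obtain z where z: "z \<in> S_Zpos" "incr (N + 1 + 1) z" "\<And>i. i < N + 1 \<Longrightarrow> z i = w i"
    "divdiffs_up d (N + 1) (schubert z) = schubert w" "\<forall>e>d. divdiffs_up e (N + 1) (schubert z) = 0"
    using Suc.IH[of "N + 1"] Suc.prems by auto
  let ?v = "z \<circ> adj N"
  have S: "?v \<in> S_Zpos" using S_Zpos_adj z(1) Suc.prems by blast
  have gt: "w N < z j" if j: "j \<ge> N + 1" for j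
  proof -
    obtain k where "k \<ge> N + 1" "z j = w k"
      using tail_value[OF assms(1) z(1), of "N + 1" j] z(3) j by blast
    then show ?thesis using incr_less[OF Suc.prems(2), of N k] by simp
  qed
  have zN: "z N = w N" using z(3) by simp
  have "?v (N + 1) < ?v N" using gt[of "N + 1"] zN by simp
  then have dd: "divdiff N (schubert ?v) = schubert z"
    using divdiff_schubert[OF S Suc.prems(1)] by simp
  have "incr (N + 1) ?v"
    unfolding incr_def
  proof (intro allI impI)
    fix i assume i: "i \<ge> N + 1"
    show "?v i < ?v (i + 1)"
    proof (cases "i = N + 1")
      case True
      then show ?thesis using gt[of "N + 1 + 1"] zN by simp
    next
      case False
      then have "z i < z (i + 1)" using z(2) i by (simp add: incr_def)
      then show ?thesis using False i by simp
    qed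
  qed
  moreover have "?v i = w i" if "i < N" for i using z(3)[of i] that by simp
  moreover have "divdiffs_up e N (schubert ?v) = 0" if "e > Suc d" for e
    using that dd z(5) by (cases e) auto
  ultimately show ?case using S dd z(4) by (intro exI[of _ ?v]) (auto simp: comp_def)
qed

lemma swap_schubert: "w \<in> S_Zpos \<Longrightarrow> 0 \<le> N \<Longrightarrow> incr (N + 1) w \<Longrightarrow> j > N \<Longrightarrow> swap_vars j (schubert w) = schubert w"
  using divdiff_schubert_ascent[of w j] by (simp add: incr_def flip: divdiff_eq_0_iff)

text \<open>By \<open>divdiffs_up_leading_coeff\<close> the operators read off coefficients at and
  above the degree. A degree above \<open>d\<close> would have leading coefficient 0, one below
  \<open>d\<close> would make \<open>schubert w\<close> zero.\<close>

lemma leading_coeff_schubert: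
  assumes "v \<in> S_Zpos" "w \<in> S_Zpos" "1 \<le> N" "incr (N + 1) v"
    "divdiffs_up d N (schubert v) = schubert w" "\<forall>e>d. divdiffs_up e N (schubert v) = 0"
  shows "degree (kap N (schubert v)) = d" "coeff (kap N (schubert v)) d = schubert w"
proof -
  have lc: "divdiffs_up e N (schubert v) = coeff (kap N (schubert v)) e" if "degree (kap N (schubert v)) \<le> e" for e
    using that swap_schubert[OF assms(1) _ assms(4)] assms(3) by (intro divdiffs_up_leading_coeff) auto
  let ?e = "degree (kap N (schubert v))"
  have "coeff (kap N (schubert v)) ?e \<noteq> 0" using schubert_neq_0[OF assms(1)] by simp
  then have "\<not> ?e > d" using lc[of ?e] assms(6) by auto
  moreover have "\<not> ?e < d"
    using lc[of d] assms(5) schubert_neq_0[OF assms(2)] by (auto simp: coeff_eq_0)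
  ultimately show "?e = d" by simp
  then show "coeff (kap N (schubert v)) d = schubert w" using lc[of d] assms(5) by simp
qed

section \<open>Schubert polynomials span\<close>

definition spanned :: "int \<Rightarrow> rpoly \<Rightarrow> bool" where
  "spanned N f \<longleftrightarrow> (\<exists>c. expands c f \<and> (\<forall>z. c z \<noteq> 0 \<longrightarrow> incr N z))"

lemma spanned_schubert: "w \<in> S_Zpos \<Longrightarrow> incr N w \<Longrightarrow> spanned N (schubert w)"
  unfolding spanned_def by (rule exI[of _ "\<lambda>z. if z = w then 1 else 0"]) (simp add: expands_schubert)

lemma spanned_add: "spanned N f \<Longrightarrow> spanned N g \<Longrightarrow> spanned N (f + g)"
proof -
  assume "spanned N f" "spanned N g"
  then obtain c d where "expands c f" "\<forall>z. c z \<noteq> 0 \<longrightarrow> incr N z" "expands d g" "\<forall>z. d z \<noteq> 0 \<longrightarrow> incr N z"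
    by (auto simp: spanned_def)
  moreover from this have "incr N z" if "c z + d z \<noteq> 0" for z
    using that by (cases "c z = 0") auto
  ultimately show ?thesis unfolding spanned_def
    by (intro exI[of _ "\<lambda>z. c z + d z"]) (auto intro: expands_add)
qed

lemma spanned_cmult: "spanned N f \<Longrightarrow> spanned N (cpoly a * f)"
proof -
  assume "spanned N f"
  then obtain c where "expands c f" "\<forall>z. c z \<noteq> 0 \<longrightarrow> incr N z" by (auto simp: spanned_def)
  then show ?thesis unfolding spanned_def
    by (intro exI[of _ "\<lambda>z. a * c z"]) (auto intro: expands_cmult)
qed

lemma spanned_0: "spanned N 0"
  unfolding spanned_def using expands_0 by (intro exI[of _ "\<lambda>_. 0"]) simp

lemma spanned_sum: "(\<And>x. x \<in> A \<Longrightarrow> spanned N (F x)) \<Longrightarrow> spanned N (sum F A)"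
  by (induction A rule: infinite_finite_induct) (auto intro: spanned_add spanned_0)

lemma spanned_mono: "spanned N f \<Longrightarrow> N \<le> M \<Longrightarrow> spanned M f"
  unfolding spanned_def using incr_mono by blast

lemma coeff_kap_subst:
  "k \<noteq> M \<Longrightarrow> coeff (kap M (subst (xvar(k := 0)) f)) n = subst (xvar(k := 0)) (coeff (kap M f) n)"
proof (induction f arbitrary: n rule: rpoly_induct)
  case (const a)
  then show ?case by (cases n) simp_all
next
  case (var i)
  then show ?case by (auto simp: kap_var coeff_pCons split: nat.split)
next
  case (add f g)
  then show ?case by (simp add: kap_add cp.psub_hom)
next
  case (mult f g)
  then show ?case by (simp add: kap_mult coeff_mult cp.psub_hom)
qed

lemma indep_coeff_kap': "indep k f \<Longrightarrow> indep k (coeff (kap M f) n)"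
proof (cases "k = M")
  case False
  assume "indep k f"
  then show ?thesis using coeff_kap_subst[OF False, of f n] by (simp add: indep_def)
qed (simp add: indep_coeff_kap)

text \<open>Induction on the number of variables, then on the degree in the last one. The leading
  coefficient has fewer variables; \<open>unsort_tail\<close> lifts each Schubert term of it to a
  Schubert polynomial with that leading coefficient, and subtracting the lifts lowers the
  degree.\<close>

lemma schubert_spanning:
  assumes "positive_vars f" "\<And>m. m > int N \<Longrightarrow> indep m f"
  shows "spanned (int N + 1) f"
  using assms
proof (induction N arbitrary: f)
  case 0
  have "indep k f" for k using 0 by (cases "k > 0") (auto simp: positive_vars_def)
  then obtain a where "f = cpoly a * schubert id"
    using indep_all_imp_ct[of f] ct_const[of f] by auto
  moreover have "spanned 1 (schubert id)" by (rule spanned_schubert) (auto simp: incr_def)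
  ultimately show ?case by (metis spanned_cmult add_0 of_nat_0)
next
  case (Suc N)
  define M where "M = int N + 1"
  have M: "M \<ge> 1" "int (Suc N) = M" by (auto simp: M_def)
  show ?case
    using Suc.prems
  proof (induction "degree (kap M f)" arbitrary: f rule: less_induct)
    case less
    define d where "d = degree (kap M f)"
    define g where "g = coeff (kap M f) d"
    have "positive_vars g"
      using less.prems(1) by (auto simp: g_def positive_vars_def intro: indep_coeff_kap')
    moreover have "indep m g" if "m > int N" for m
    proof (cases "m = M")
      case True
      then show ?thesis by (simp add: g_def indep_coeff_kap)
    next
      case False
      then show ?thesis using that less.prems(2)[of m] M by (auto simp: g_def M_def intro: indep_coeff_kap')
    qed
    ultimately have sg: "spanned M g" using Suc.IH[of g] by (simp add: M_def)
    show ?case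
    proof (cases "d = 0")
      case True
      then obtain a where a: "kap M f = [:a:]" unfolding d_def by (rule degree_eq_zeroE)
      have "f = poly (kap M f) (xvar M)" by (simp add: poly_kap)
      then have "f = g" using a True by (simp add: g_def)
      then show ?thesis using sg spanned_mono[of M g "M + 1"] M by simp
    next
      case False
      obtain c where c: "expands c g" "\<And>z. c z \<noteq> 0 \<Longrightarrow> incr M z" using sg by (auto simp: spanned_def)
      define A where "A = {z. c z \<noteq> 0}"
      have A: "finite A" "A \<subseteq> S_Zpos" "g = (\<Sum>z\<in>A. cpoly (c z) * schubert z)"
        using c by (auto simp: expands_def A_def)
      have "\<exists>v. v \<in> S_Zpos \<and> incr (M + 1) v \<and> degree (kap M (schubert v)) = d \<and> coeff (kap M (schubert v)) d = schubert z"
        if "z \<in> A" for z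
      proof -
        have z: "z \<in> S_Zpos" "incr M z" using that A c by (auto simp: A_def)
        obtain v where v: "v \<in> S_Zpos" "incr (M + 1) v"
          "divdiffs_up d M (schubert v) = schubert z" "\<forall>e>d. divdiffs_up e M (schubert v) = 0"
          using unsort_tail[OF z(1) M(1) z(2), of d] by blast
        then show ?thesis using leading_coeff_schubert[OF v(1) z(1) M(1) v(2-4)] by blast
      qed
      then obtain up where up: "\<And>z. z \<in> A \<Longrightarrow> up z \<in> S_Zpos" "\<And>z. z \<in> A \<Longrightarrow> incr (M + 1) (up z)"
        "\<And>z. z \<in> A \<Longrightarrow> degree (kap M (schubert (up z))) = d"
        "\<And>z. z \<in> A \<Longrightarrow> coeff (kap M (schubert (up z))) d = schubert z"
        by metis
      define h where "h = (\<Sum>z\<in>A. cpoly (c z) * schubert (up z))"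
      have sh: "spanned (M + 1) h"
        unfolding h_def using up by (intro spanned_sum spanned_cmult spanned_schubert) auto
      have kh: "coeff (kap M h) n = (\<Sum>z\<in>A. cpoly (c z) * coeff (kap M (schubert (up z))) n)" for n
        by (simp add: h_def kap_sum kap_mult coeff_sum)
      have "coeff (kap M (f - h)) n = 0" if "n \<ge> d" for n
      proof (cases "n = d")
        case True
        then show ?thesis using up(4) by (simp add: kap_diff kh A(3)[symmetric] flip: g_def)
      next
        case False
        then show ?thesis using up(3) that by (simp add: kap_diff kh coeff_eq_0 d_def[symmetric])
      qed
      then have deg: "degree (kap M (f - h)) < degree (kap M f)"
        using False unfolding d_def by (intro degree_lessI) auto
      have "positive_vars (f - h)"
        using less.prems(1) positive_vars_schubert up(1)
        unfolding positive_vars_def h_def by (auto intro!: indep_hom)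
      moreover have "indep m (f - h)" if "m > int (Suc N)" for m
      proof -
        have "indep m (schubert (up z))" if "z \<in> A" for z
          using symmetric_imp_indep[of M "schubert (up z)" m] swap_schubert[of "up z" M] up that M \<open>m > int (Suc N)\<close> by auto
        then show ?thesis using less.prems(2)[OF that] unfolding h_def by (auto intro!: indep_hom)
      qed
      ultimately have "spanned (int (Suc N) + 1) (f - h)" by (rule less.hyps[OF deg])
      then have "spanned (M + 1) (f - h)" unfolding M(2) .
      from spanned_add[OF this sh] show ?thesis unfolding M(2) by simp
    qed
  qed
qed

lemma schubert_product_expands:
  assumes "u \<in> S_Zpos" "v \<in> S_Zpos"
  shows "\<exists>c. expands c (schubert u * schubert v)"
proof -
  let ?f = "schubert u * schubert v"
  have "positive_vars ?f"
    using positive_vars_schubert[OF assms(1)] positive_vars_schubert[OF assms(2)]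
    by (auto simp: positive_vars_def intro: indep_hom)
  moreover obtain M where M: "\<forall>m\<ge>M. indep m ?f" using eventually_indep by blast
  have "indep m ?f" if "m > int (nat M)" for m
  proof -
    have "m \<ge> M" using that by linarith
    then show ?thesis using M by blast
  qed
  ultimately have "spanned (int (nat M) + 1) ?f" by (rule schubert_spanning)
  then show ?thesis by (auto simp: spanned_def)
qed

lemma schubert_const_eq:
  assumes "u \<in> S_Zpos" "v \<in> S_Zpos" "expands c (schubert u * schubert v)"
  shows "schubert_const u v w = c w"
proof (cases "w \<in> S_Zpos")
  case True
  have "(THE c. expands c (schubert u * schubert v)) = c"
    using assms(3) expands_unique by blast
  then show ?thesis using assms True by (simp add: schubert_const_def expands_def)
next
  case False
  then show ?thesis using assms(3) by (auto simp: schubert_const_def expands_def)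
qed

text \<open>\<open>drop1\<close> maps the product of the shifted polynomials to the original product
  and keeps the coefficients of the terms that fix 1.\<close>

lemma schubert_const_gshift:
  assumes "u \<in> S_Zpos" "v \<in> S_Zpos" "w \<in> S_Zpos"
  shows "schubert_const (gshift u) (gshift v) (gshift w) = schubert_const u v w"
proof -
  obtain c where c: "expands c (schubert (gshift u) * schubert (gshift v))"
    using schubert_product_expands gshift_S_Zpos assms by blast
  have "drop1 (schubert (gshift u) * schubert (gshift v)) = schubert u * schubert v"
    using assms by (simp add: drop1_hom drop1_schubert gshift_S_Zpos gshift_1)
  then have "expands (\<lambda>y. if y \<in> S_Zpos then c (gshift y) else 0) (schubert u * schubert v)"
    using expands_drop1[OF c] by simp
  then show ?thesis
    using schubert_const_eq[OF assms(1,2)] schubert_const_eq[OF _ _ c] assms gshift_S_Zpos by simp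
qed

section \<open>The statistics \<open>theta\<close> and \<open>lam\<close>\<close>

lemma theta_nonneg: "theta i w \<ge> 0" and theta_le_1: "theta i w \<le> 1"
  by (auto simp: theta_def)

lemma theta_nonpos: "w \<in> S_Zpos \<Longrightarrow> i \<le> 0 \<Longrightarrow> theta i w = 0"
proof -
  assume w: "w \<in> S_Zpos" "i \<le> 0"
  have "w j \<ge> w i" if "j > i" for j
    using w that S_Zpos_pos[OF w(1), of j] by (cases "j \<ge> 1") (auto simp: S_Zpos_def)
  then show ?thesis by (force simp: theta_def)
qed

lemma theta_fixed_1: "w \<in> S_Zpos \<Longrightarrow> w 1 = 1 \<Longrightarrow> theta 1 w = 0"
proof -
  assume w: "w \<in> S_Zpos" "w 1 = 1"
  have "\<not> w j < w 1" if "j > 1" for j using S_Zpos_pos[OF w(1), of j] w(2) that by simp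
  then show ?thesis by (auto simp: theta_def)
qed

lemma theta_descent: "w (i + 1) < w i \<Longrightarrow> theta i w = 1"
  by (auto simp: theta_def intro!: exI[of _ "i + 1"])

lemma theta_incr: "incr i w \<Longrightarrow> theta i w = 0"
  using incr_less[of i w i] by (force simp: theta_def)

lemma lam_nonpos: "w \<in> S_Zpos \<Longrightarrow> i \<le> 0 \<Longrightarrow> lam i w = 0"
  unfolding lam_def by (intro sum.neutral) (auto simp: theta_nonpos)

lemma finite_theta_below: "w \<in> S_Zpos \<Longrightarrow> finite {j. j \<le> i \<and> theta j w \<noteq> 0}"
proof -
  assume w: "w \<in> S_Zpos"
  have "1 \<le> j" if "theta j w \<noteq> 0" for j using theta_nonpos[OF w, of j] that by force
  then have "{j. j \<le> i \<and> theta j w \<noteq> 0} \<subseteq> {1..i}" by auto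
  then show ?thesis by (rule finite_subset) simp
qed

lemma lam_add1: "w \<in> S_Zpos \<Longrightarrow> lam (i + 1) w = lam i w + theta (i + 1) w"
proof -
  assume w: "w \<in> S_Zpos"
  let ?S = "{j. j \<le> i \<and> theta j w \<noteq> 0}"
  show ?thesis
  proof (cases "theta (i + 1) w = 0")
    case True
    then have "{j. j \<le> i + 1 \<and> theta j w \<noteq> 0} = ?S"
      by (auto simp: le_less)
    then show ?thesis using True by (simp add: lam_def)
  next
    case False
    then have "{j. j \<le> i + 1 \<and> theta j w \<noteq> 0} = insert (i + 1) ?S"
      by (auto simp: le_less)
    then show ?thesis using finite_theta_below[OF w, of i] by (simp add: lam_def)
  qed
qed

lemma lam_nonneg: "lam i w \<ge> 0"
  unfolding lam_def by (intro sum_nonneg) (simp add: theta_nonneg)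

lemma lam_le: "w \<in> S_Zpos \<Longrightarrow> lam (int n) w \<le> int n"
proof (induction n)
  case 0
  then show ?case by (simp add: lam_nonpos)
next
  case (Suc n)
  then show ?case using lam_add1[of w "int n"] theta_le_1[of "int n + 1" w] by (simp add: add.commute)
qed

lemma lam_le_fixed_1: "w \<in> S_Zpos \<Longrightarrow> w 1 = 1 \<Longrightarrow> lam (int n + 1) w \<le> int n"
proof (induction n)
  case 0
  then show ?case using lam_add1[of w 0] by (simp add: lam_nonpos theta_fixed_1)
next
  case (Suc n)
  then show ?case using lam_add1[of w "int n + 1"] theta_le_1[of "int n + 1 + 1" w] by (simp add: add.commute)
qed

text \<open>\<open>theta i\<close> depends only on \<open>w i\<close> and the set of later values,
  which \<open>tail_value\<close> preserves.\<close>

lemma theta_tail: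
  assumes "w \<in> S_Zpos" "v \<in> S_Zpos" "\<And>i. i < M \<Longrightarrow> v i = w i" "i < M"
  shows "theta i v = theta i w"
proof -
  have imp: "\<exists>j>i. w' j < w' i" if a: "w' \<in> S_Zpos" "v' \<in> S_Zpos" "\<And>i. i < M \<Longrightarrow> v' i = w' i" "\<exists>j>i. v' j < v' i" for v' w'
  proof -
    obtain j where j: "j > i" "v' j < v' i" using a(4) by blast
    show ?thesis
    proof (cases "j < M")
      case True
      then show ?thesis using j a(3) assms(4) by auto
    next
      case False
      then obtain k where "k \<ge> M" "v' j = w' k" using tail_value[of w' v' M j] a by auto
      then show ?thesis using j a(3)[OF assms(4)] assms(4) by (intro exI[of _ k]) auto
    qed
  qed
  show ?thesis using imp[of w v] imp[of v w] assms by (auto simp: theta_def)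
qed

lemma lam_tail:
  assumes "w \<in> S_Zpos" "v \<in> S_Zpos" "\<And>i. i < M \<Longrightarrow> v i = w i" "i < M"
  shows "lam i v = lam i w"
proof -
  have "theta j v = theta j w" if "j \<le> i" for j
    using theta_tail[of w v M j] assms that by auto
  then show ?thesis unfolding lam_def by (intro sum.cong) auto
qed

lemma lam_adj: "w \<in> S_Zpos \<Longrightarrow> 1 \<le> i \<Longrightarrow> n < i \<Longrightarrow> lam n (w \<circ> adj i) = lam n w"
  by (rule lam_tail[of w _ i]) (auto intro: S_Zpos_adj)

section \<open>Degrees of \<open>Psi\<close> on Schubert polynomials\<close>

text \<open>In the recursion the degree can rise only through \<open>divdiff (int n + 1)\<close>.
  That term survives only at a descent, where \<open>theta\<close> is 1, and the exchange does not
  change \<open>lam (int n)\<close>.\<close>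

lemma degree_Psi_schubert:
  "w \<in> S_Zpos \<Longrightarrow> degree (kap (int n + 1) (Psi n (schubert w))) \<le> nat (lam (int n) w)"
proof (induction n arbitrary: w)
  case 0
  then show ?case using degree_kap_Psi[of 0 "schubert w"] by simp
next
  case (Suc n)
  let ?i = "int n + 1"
  have e: "int (Suc n) + 1 = int n + 2" "int (Suc n) = int n + 1" "?i + 1 = int n + 2" by simp_all
  have lam: "lam ?i w = lam (int n) w + theta ?i w" using lam_add1 Suc.prems by simp
  show ?case
  proof (cases "w (?i + 1) < w ?i")
    case True
    have "degree (kap (int n + 2) (Psi (Suc n) (schubert w))) \<le> Suc (nat (lam (int n) w))"
    proof (rule degree_kap_Psi_Suc)
      show "degree (kap ?i (Psi n (schubert w))) \<le> Suc (nat (lam (int n) w))"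
        using Suc.IH[OF Suc.prems] by simp
      have "degree (kap ?i (Psi n (schubert (w \<circ> adj ?i)))) \<le> nat (lam (int n) (w \<circ> adj ?i))"
        by (rule Suc.IH[OF S_Zpos_adj[OF Suc.prems]]) simp
      then show "degree (kap ?i (Psi n (divdiff ?i (schubert w)))) \<le> nat (lam (int n) w)"
        using lam_adj[OF Suc.prems, of ?i "int n"] divdiff_schubert[OF Suc.prems _ True] by simp
    qed
    moreover have "nat (lam ?i w) = Suc (nat (lam (int n) w))"
      using lam theta_descent[of w ?i, OF True] lam_nonneg[of "int n" w] by simp
    ultimately show ?thesis by (simp only: e)
  next
    case False
    then have "w ?i < w (?i + 1)" using S_Zpos_inj[OF Suc.prems, of ?i "?i + 1"] by force
    then have "Psi (Suc n) (schubert w) = swap_vars ?i (Psi n (schubert w))"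
      using divdiff_schubert_ascent[OF Suc.prems, of ?i] by simp
    then have "degree (kap (int n + 2) (Psi (Suc n) (schubert w))) = degree (kap ?i (Psi n (schubert w)))"
      using degree_kap_swap[of ?i ?i "Psi n (schubert w)"] by (simp add: add.assoc)
    also have "\<dots> \<le> nat (lam (int n) w)" by (rule Suc.IH[OF Suc.prems])
    also have "\<dots> \<le> nat (lam ?i w)" using lam theta_nonneg[of ?i w] by simp
    finally show ?thesis by (simp only: e)
  qed
qed

lemma Psi_divdiffs_up: "N \<ge> int n + 2 \<Longrightarrow> Psi n (divdiffs_up d N f) = divdiffs_up d N (Psi n f)"
  by (induction d arbitrary: N f) (simp_all add: Psi_divdiff_commute)

lemma coeff_kap_divdiffs_up:
  "k < N \<Longrightarrow> coeff (kap k (divdiffs_up d N f)) m = divdiffs_up d N (coeff (kap k f) m)"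
  by (induction d arbitrary: N f) (simp_all add: coeff_kap_divdiff)

text \<open>In the step, \<open>incr\<close> makes \<open>theta\<close> at position
  \<open>n + 1\<close> nonzero only at a descent. There the coefficient comes from the permutation
  after the exchange; its tail may be unsorted, so the induction hypothesis is applied to the result
  of \<open>sort_tail\<close>.\<close>

lemma coeff_Psi_schubert:
  "w \<in> S_Zpos \<Longrightarrow> incr (int n + 1) w \<Longrightarrow>
    coeff (kap (int n + 1) (Psi n (schubert w))) (nat (lam (int n) w)) \<noteq> 0"
proof (induction n arbitrary: w)
  case 0
  then have "w = id" by (intro S_Zpos_increasing_id) (auto simp: incr_def)
  moreover have "Psi 0 (schubert id) = 1" by simp
  ultimately show ?case using 0 by (simp add: lam_nonpos)
next
  case (Suc n)
  let ?i = "int n + 1"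
  let ?L = "nat (lam (int n) w)"
  have e: "int (Suc n) + 1 = int n + 2" "int (Suc n) = int n + 1" "?i + 1 = int n + 2" by simp_all
  have inc: "incr (?i + 1) w" using Suc.prems(2) by (simp only: e)
  have lam: "lam ?i w = lam (int n) w + theta ?i w" using lam_add1 Suc.prems by simp
  show ?case
  proof (cases "w ?i < w (?i + 1)")
    case True
    then have inc': "incr ?i w" by (rule incr_extend[OF inc])
    have "Psi (Suc n) (schubert w) = swap_vars ?i (Psi n (schubert w))"
      using divdiff_schubert_ascent[OF Suc.prems(1) _ True] by simp
    then have "coeff (kap (int n + 2) (Psi (Suc n) (schubert w))) ?L = swap_vars ?i (coeff (kap ?i (Psi n (schubert w))) ?L)"
      using coeff_kap_swap[of ?i ?i "Psi n (schubert w)" ?L] by (simp add: add.assoc)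
    moreover have "lam ?i w = lam (int n) w" using lam theta_incr[OF inc'] by simp
    ultimately show ?thesis using Suc.IH[OF Suc.prems(1) inc'] by (simp only: e swap_eq_0_iff not_False_eq_True)
  next
    case False
    then have desc: "w (?i + 1) < w ?i" using S_Zpos_inj[OF Suc.prems(1), of ?i "?i + 1"] by force
    define w' where "w' = w \<circ> adj ?i"
    have w': "w' \<in> S_Zpos" unfolding w'_def by (rule S_Zpos_adj[OF Suc.prems(1)]) simp
    have lam': "lam (int n) w' = lam (int n) w" using lam_adj[OF Suc.prems(1), of ?i "int n"] by (simp add: w'_def)
    have dd: "divdiff ?i (schubert w) = schubert w'" using divdiff_schubert[OF Suc.prems(1) _ desc] by (simp add: w'_def)
    have "incr (?i + 1 + 1) w'"
      using inc by (auto simp: incr_def transpose_def w'_def)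
    then obtain d v where v: "v \<in> S_Zpos" "incr (?i + 1) v" "\<forall>i<?i + 1. v i = w' i"
      "divdiffs_up d (?i + 1) (schubert w') = schubert v"
      using sort_tail[OF w', of "?i + 1"] by auto
    have vi: "v ?i = w (?i + 1)" using v(3) by (simp add: w'_def)
    obtain k where k: "k \<ge> ?i + 1" "v (?i + 1) = w' k"
      using tail_value[OF w' v(1), of "?i + 1" "?i + 1"] v(3) by blast
    have "w (?i + 1) < w' k"
    proof (cases "k = ?i + 1")
      case True
      then show ?thesis using desc by (simp add: w'_def)
    next
      case False
      then show ?thesis using k(1) incr_less[OF inc, of "?i + 1" k] by (simp add: w'_def)
    qed
    then have "v ?i < v (?i + 1)" using vi k by simp
    then have "incr ?i v" by (rule incr_extend[OF v(2)])
    moreover have "lam (int n) v = lam (int n) w"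
      using lam_tail[OF w' v(1), of "?i + 1" "int n"] v(3) lam' by simp
    ultimately have "coeff (kap ?i (Psi n (schubert v))) ?L \<noteq> 0" using Suc.IH[OF v(1)] by simp
    \<comment> \<open>The operators have indices beyond \<open>?i\<close>, so they commute with
      \<open>Psi n\<close> and with taking coefficients. They map 0 to 0, hence nonvanishing for
      \<open>v\<close> forces it for \<open>w'\<close>.\<close>
    also have "coeff (kap ?i (Psi n (schubert v))) ?L = divdiffs_up d (?i + 1) (coeff (kap ?i (Psi n (schubert w'))) ?L)"
      by (simp add: v(4)[symmetric] Psi_divdiffs_up coeff_kap_divdiffs_up)
    finally have nz: "coeff (kap ?i (Psi n (schubert w'))) ?L \<noteq> 0" by auto
    have "coeff (kap (int n + 2) (Psi (Suc n) (schubert w))) (Suc ?L) = - swap_vars ?i (coeff (kap ?i (Psi n (schubert w'))) ?L)"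
      using coeff_kap_Psi_Suc[of n "schubert w" ?L] degree_Psi_schubert[OF Suc.prems(1), of n]
        degree_Psi_schubert[OF w', of n] by (simp add: dd lam')
    moreover have "nat (lam ?i w) = Suc ?L"
      using lam theta_descent[of w ?i, OF desc] lam_nonneg[of "int n" w] by simp
    ultimately show ?thesis using nz by (simp only: e neg_equal_0_iff_equal swap_eq_0_iff) simp
  qed
qed

section \<open>Products all of whose terms fix 1\<close>

text \<open>A 1 right of a larger value is a descent, so each divided difference moves it one place
  left and keeps the coefficient. After \<open>n\<close> of them it stands at position 1, where
  \<open>drop1\<close> sees it.\<close>

lemma expansion_vanishes:
  assumes "expands c f" "drop1 (divdiffs_down n f) = 0" "z \<in> S_Zpos" "z (int n + 1) = 1"
  shows "c z = 0"
  using assms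
proof (induction n arbitrary: c f z)
  case 0
  have "expands (\<lambda>y. if y \<in> S_Zpos then c (gshift y) else 0) 0"
    using expands_drop1[OF 0(1)] 0(2) by simp
  from expands_0_imp_0[OF this, of "unshift z"] show ?case
    using 0 unshift_S_Zpos[of z] by simp
next
  case (Suc n)
  let ?i = "int n + 1"
  define c' where "c' y = (if y ?i < y (?i + 1) then c (y \<circ> adj ?i) else 0)" for y
  have c': "expands c' (divdiff ?i f)"
    using expands_divdiff[OF Suc.prems(1), of ?i] by (simp add: c'_def[abs_def])
  define y where "y = z \<circ> adj ?i"
  have y: "y \<in> S_Zpos" unfolding y_def by (rule S_Zpos_adj[OF Suc.prems(3)]) simp
  have y1: "y ?i = 1" using Suc.prems(4) by (simp add: y_def add.commute)
  have "c' y = 0" by (rule Suc.IH[OF c' _ y y1]) (use Suc.prems(2) in simp)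
  moreover have "y ?i < y (?i + 1)"
    using y1 S_Zpos_pos[OF y, of "?i + 1"] S_Zpos_inj[OF y, of ?i "?i + 1"] by force
  ultimately have "c (y \<circ> adj ?i) = 0" by (simp only: c'_def if_True)
  then show ?case by (simp only: y_def comp_adj_adj)
qed

text \<open>If 1 stood at position \<open>k > 1\<close> of \<open>z\<close>, \<open>Psi\<close> at
  index \<open>k - 1\<close> would be multiplicative on the product and of degree below
  \<open>k - 1\<close>; the vanishing top coefficient then kills \<open>c z\<close>.\<close>

lemma product_fixes_1:
  assumes "u \<in> S_Zpos" "v \<in> S_Zpos" "expands c (schubert u * schubert v)"
    and lam: "\<And>j. j \<ge> 1 \<Longrightarrow> lam j u + lam j v \<le> j - 1" and z: "c z \<noteq> 0"
  shows "z 1 = 1"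
proof (rule ccontr)
  assume z1: "z 1 \<noteq> 1"
  have zS: "z \<in> S_Zpos" using assms(3) z by (auto simp: expands_def)
  then have "surj z" by (auto simp: S_Zpos_def S_Z_def bij_def)
  then obtain k where k: "z k = 1" by (metis surjD)
  have "k > 1"
  proof (rule ccontr)
    assume "\<not> k > 1"
    then have "k \<le> 0" using z1 k by (cases "k = 1") auto
    then show False using k zS by (auto simp: S_Zpos_def)
  qed
  \<comment> \<open>\<open>Suc n = k - 1\<close> is the number of places that 1 has to
    travel.\<close>
  define n where "n = nat (k - 2)"
  have n: "k = int (Suc n) + 1" using \<open>k > 1\<close> by (simp add: n_def)
  let ?deg = "\<lambda>m w. degree (kap (int m + 1) (Psi m (schubert w)))"
  have sum: "int (?deg m u + ?deg m v) \<le> lam (int m) u + lam (int m) v" for m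
    using degree_Psi_schubert[OF assms(1), of m] degree_Psi_schubert[OF assms(2), of m]
      lam_nonneg[of "int m" u] lam_nonneg[of "int m" v] by linarith
  \<comment> \<open>The hypothesis \<open>lam\<close> starts at index 1; at \<open>m = 0\<close>
    both values of \<open>lam\<close> are 0.\<close>
  have "?deg m u + ?deg m v \<le> m" for m
    using sum[of m] lam[of "int m"] lam_nonpos[OF assms(1), of 0] lam_nonpos[OF assms(2), of 0]
    by (cases "m = 0") auto
  then have "Psi (Suc n) (schubert u * schubert v) = Psi (Suc n) (schubert u) * Psi (Suc n) (schubert v)"
    by (intro Psi_mult)
  then have "degree (kap (int (Suc n) + 1) (Psi (Suc n) (schubert u * schubert v))) \<le> ?deg (Suc n) u + ?deg (Suc n) v"
    by (simp only: kap_mult degree_mult_le)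
  also have "\<dots> < Suc n" using sum[of "Suc n"] lam[of "int (Suc n)"] by linarith
  finally have "coeff (kap (int (Suc n) + 1) (Psi (Suc n) (schubert u * schubert v))) (Suc n) = 0"
    by (rule coeff_eq_0)
  then have "drop1 (divdiffs_down (Suc n) (schubert u * schubert v)) = 0"
    by (intro drop1_eq_0 top_coeff_Psi)
  then have "c z = 0"
    by (rule expansion_vanishes[OF assms(3) _ zS]) (use k n in simp)
  then show False using z by simp
qed

text \<open>With \<open>N \<ge> 2\<close> the exchanges never touch position 1.\<close>

lemma expands_divdiffs_up_fixes_1:
  assumes "expands c f" "\<And>z. c z \<noteq> 0 \<Longrightarrow> z 1 = 1" "N \<ge> 2"
  shows "\<exists>c'. expands c' (divdiffs_up d N f) \<and> (\<forall>z. c' z \<noteq> 0 \<longrightarrow> z 1 = 1)"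
  using assms
proof (induction d arbitrary: c f N)
  case 0
  then show ?case by auto
next
  case (Suc d)
  let ?c = "\<lambda>y. if y N < y (N + 1) then c (y \<circ> adj N) else 0"
  have "expands ?c (divdiff N f)" using expands_divdiff Suc.prems by simp
  moreover have "z 1 = 1" if "?c z \<noteq> 0" for z
    using Suc.prems(2)[of "z \<circ> adj N"] Suc.prems(3) that by (auto simp: comp_def split: if_splits)
  ultimately show ?case using Suc.IH[of ?c "divdiff N f" "N + 1"] Suc.prems(3) by simp
qed

text \<open>In the induction step, leading coefficients in \<open>xvar M\<close> yield a product
  whose terms still fix 1 and which keeps \<open>lam i\<close> for \<open>i < M\<close>; this
  settles \<open>j < M\<close>. For \<open>j = M\<close> the product of the two \<open>Psi\<close>
  has degree at least the sum of both \<open>lam M\<close>, while each term stays below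
  \<open>M\<close>.\<close>

lemma product_fixes_1_imp:
  assumes "u \<in> S_Zpos" "v \<in> S_Zpos" "u 1 = 1" "v 1 = 1" "incr (int N + 1) u" "incr (int N + 1) v"
    and "expands c (schubert u * schubert v)" "\<And>z. c z \<noteq> 0 \<Longrightarrow> z 1 = 1" "1 \<le> j" "j \<le> int N"
  shows "lam j u + lam j v \<le> j - 1"
  using assms
proof (induction N arbitrary: u v c j)
  case (Suc N)
  define M where "M = int N + 1"
  have M: "int (Suc N) = M" "M \<ge> 1" "int (Suc N) + 1 = M + 1" by (auto simp: M_def)
  note u = Suc.prems(1,3) and v = Suc.prems(2,4)
  have inc: "incr (M + 1) u" "incr (M + 1) v" using Suc.prems(5,6) unfolding M(3) by auto
  show ?case
  proof (cases "N = 0")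
    \<comment> \<open>Here \<open>M = 1\<close>, and divided differences at index 1 could move the
      value 1.\<close>
    case True
    then have "j = 0 + 1" using Suc.prems(9,10) by simp
    then show ?thesis
      using lam_add1[OF u(1), of 0] lam_add1[OF v(1), of 0] theta_fixed_1[OF u] theta_fixed_1[OF v]
        lam_nonpos[OF u(1), of 0] lam_nonpos[OF v(1), of 0] by simp
  next
    case False
    then have M2: "M \<ge> 2" by (simp add: M_def)
    obtain d u' where u': "u' \<in> S_Zpos" "incr M u'" "\<And>i. i < M \<Longrightarrow> u' i = u i"
      "divdiffs_up d M (schubert u) = schubert u'" "\<forall>e>d. divdiffs_up e M (schubert u) = 0"
      using sort_tail[OF u(1) M(2) inc(1)] by blast
    obtain e v' where v': "v' \<in> S_Zpos" "incr M v'" "\<And>i. i < M \<Longrightarrow> v' i = v i"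
      "divdiffs_up e M (schubert v) = schubert v'" "\<forall>d>e. divdiffs_up d M (schubert v) = 0"
      using sort_tail[OF v(1) M(2) inc(2)] by blast
    note lu = leading_coeff_schubert[OF u(1) u'(1) M(2) inc(1) u'(4,5)]
    note lv = leading_coeff_schubert[OF v(1) v'(1) M(2) inc(2) v'(4,5)]
    let ?F = "schubert u * schubert v"
    have kF: "kap M ?F = kap M (schubert u) * kap M (schubert v)" by (rule kap_mult)
    have "degree (kap M ?F) \<le> d + e" unfolding kF using degree_mult_le lu(1) lv(1) by metis
    moreover have "swap_vars j ?F = ?F" if "j > M" for j
      using swap_schubert[OF u(1) _ inc(1) that] swap_schubert[OF v(1) _ inc(2) that] M(2) by (simp add: swap_mult)
    ultimately have "divdiffs_up (d + e) M ?F = coeff (kap M ?F) (d + e)"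
      by (intro divdiffs_up_leading_coeff)
    also have "\<dots> = schubert u' * schubert v'"
      unfolding kF using coeff_mult_degree_sum[of "kap M (schubert u)" "kap M (schubert v)"] lu lv by simp
    finally obtain c' where c': "expands c' (schubert u' * schubert v')" "\<And>z. c' z \<noteq> 0 \<Longrightarrow> z 1 = 1"
      using expands_divdiffs_up_fixes_1[of c ?F M "d + e"] Suc.prems(7,8) M2 by auto
    have one: "u' 1 = 1" "v' 1 = 1" using u'(3)[of 1] v'(3)[of 1] u v M2 by auto
    have small: "lam i u + lam i v \<le> i - 1" if "1 \<le> i" "i \<le> int N" for i
    proof -
      have "lam i u' + lam i v' \<le> i - 1"
        using Suc.IH[OF u'(1) v'(1) one, of c' i] c' that u'(2) v'(2) by (simp add: M_def)
      moreover have "lam i u' = lam i u" "lam i v' = lam i v"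
        using lam_tail[OF u(1) u'(1), of M i] lam_tail[OF v(1) v'(1), of M i] u'(3) v'(3) that by (auto simp: M_def)
      ultimately show ?thesis by simp
    qed
    show ?thesis
    proof (cases "j = M")
      case False
      then show ?thesis using small Suc.prems(9,10) by (simp add: M_def)
    next
      case True
      let ?deg = "\<lambda>m w. degree (kap (int m + 1) (Psi m (schubert w)))"
      have sum: "int (?deg m u + ?deg m v) \<le> lam (int m) u + lam (int m) v" for m
        using degree_Psi_schubert[OF u(1), of m] degree_Psi_schubert[OF v(1), of m]
          lam_nonneg[of "int m" u] lam_nonneg[of "int m" v] by linarith
      \<comment> \<open>The bound \<open>N - 1\<close> at index \<open>N\<close> grows by at most 2,
        which is just what \<open>Psi_mult\<close> tolerates.\<close>
      have lamM: "lam M u + lam M v \<le> M"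
        using small[of "int N"] False lam_add1[OF u(1), of "int N"] lam_add1[OF v(1), of "int N"] \<open>N \<noteq> 0\<close>
          theta_le_1[of "int N + 1" u] theta_le_1[of "int N + 1" v] by (simp add: M_def)
      have "?deg m u + ?deg m v \<le> m" if m: "m \<le> Suc N" for m
      proof -
        consider "m = 0" | "1 \<le> int m" "int m \<le> int N" | "int m = M" using m unfolding M_def by linarith
        then show ?thesis
          using sum[of m] small[of "int m"] lamM lam_nonpos[OF u(1), of 0] lam_nonpos[OF v(1), of 0]
          by cases auto
      qed
      then have "Psi (Suc N) ?F = Psi (Suc N) (schubert u) * Psi (Suc N) (schubert v)"
        by (intro Psi_mult)
      then have kP: "kap (M + 1) (Psi (Suc N) ?F) =
          kap (M + 1) (Psi (Suc N) (schubert u)) * kap (M + 1) (Psi (Suc N) (schubert v))"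
        by (simp only: kap_mult)
      have ge: "kap (M + 1) (Psi (Suc N) (schubert w)) \<noteq> 0 \<and> nat (lam M w) \<le> degree (kap (M + 1) (Psi (Suc N) (schubert w)))"
        if "w \<in> S_Zpos" "incr (M + 1) w" for w
      proof -
        have "coeff (kap (M + 1) (Psi (Suc N) (schubert w))) (nat (lam M w)) \<noteq> 0"
          using coeff_Psi_schubert[OF that(1), of "Suc N"] that(2) unfolding M by simp
        then show ?thesis by (metis coeff_0 le_degree)
      qed
      have "nat (lam M u) + nat (lam M v) \<le> degree (kap (M + 1) (Psi (Suc N) ?F))"
        unfolding kP using ge[OF u(1) inc(1)] ge[OF v(1) inc(2)] by (simp add: degree_mult_eq)
      also have "\<dots> \<le> N"
      proof -
        have F: "?F = (\<Sum>z | c z \<noteq> 0. cpoly (c z) * schubert z)"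
          and cS: "finite {z. c z \<noteq> 0}" "{z. c z \<noteq> 0} \<subseteq> S_Zpos"
          using Suc.prems(7) by (auto simp: expands_def)
        have "degree (kap (M + 1) (Psi (Suc N) (cpoly (c z) * schubert z))) \<le> N" if "z \<in> {z. c z \<noteq> 0}" for z
        proof -
          have z: "z \<in> S_Zpos" "z 1 = 1" using that cS Suc.prems(8) by auto
          have "degree (kap (M + 1) (Psi (Suc N) (cpoly (c z) * schubert z))) \<le> degree (kap (M + 1) (Psi (Suc N) (schubert z)))"
            unfolding Psi_cmult kap_mult by (rule order_trans[OF degree_mult_le]) simp
          also have "\<dots> \<le> nat (lam M z)" using degree_Psi_schubert[OF z(1), of "Suc N"] unfolding M .
          \<comment> \<open>Since \<open>z\<close> fixes 1, \<open>theta 1 z = 0\<close>, so at most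
            \<open>N\<close> of the first \<open>N + 1\<close> positions count.\<close>
          also have "\<dots> \<le> N" using lam_le_fixed_1[OF z, of N] by (simp add: M_def)
          finally show ?thesis .
        qed
        then show ?thesis unfolding F Psi_sum kap_sum using cS(1) by (intro degree_sum_le) auto
      qed
      finally show ?thesis
        using True lam_nonneg[of M u] lam_nonneg[of M v] by (simp add: M_def)
    qed
  qed
qed simp

lemma perm_on_incr: "perm_on n w \<Longrightarrow> incr (int n + 1) w"
  by (auto simp: incr_def perm_on_def)

lemma product_fixes_1_iff:
  assumes "u \<in> S_Zpos" "v \<in> S_Zpos" "u 1 = 1" "v 1 = 1"
  shows "(\<forall>z. schubert_const u v z \<noteq> 0 \<longrightarrow> z 1 = 1) \<longleftrightarrow> (\<forall>j\<ge>1. lam j u + lam j v \<le> j - 1)"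
proof -
  obtain c where c: "expands c (schubert u * schubert v)"
    using schubert_product_expands assms by blast
  have sc: "schubert_const u v z = c z" for z using schubert_const_eq assms c by blast
  show ?thesis
  proof
    assume L: "\<forall>z. schubert_const u v z \<noteq> 0 \<longrightarrow> z 1 = 1"
    show "\<forall>j\<ge>1. lam j u + lam j v \<le> j - 1"
    proof (intro allI impI)
      fix j :: int assume j: "j \<ge> 1"
      obtain n m where nm: "perm_on n u" "perm_on m v" using S_Zpos_perm_on assms by blast
      \<comment> \<open>Chosen beyond the supports of \<open>u\<close> and \<open>v\<close> and at
        least \<open>j\<close>.\<close>
      let ?N = "n + m + nat j"
      have "incr (int ?N + 1) u" by (rule perm_on_incr[OF perm_on_mono[OF nm(1)]]) simp
      moreover have "incr (int ?N + 1) v" by (rule perm_on_incr[OF perm_on_mono[OF nm(2)]]) simp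
      ultimately show "lam j u + lam j v \<le> j - 1"
        using product_fixes_1_imp[OF assms _ _ c, of ?N j] L sc j by simp
    qed
  next
    assume "\<forall>j\<ge>1. lam j u + lam j v \<le> j - 1"
    then show "\<forall>z. schubert_const u v z \<noteq> 0 \<longrightarrow> z 1 = 1"
      using product_fixes_1[OF assms(1,2) c] sc by simp
  qed
qed

section \<open>Stabilization\<close>

lemma theta_gshift: "theta (i + 1) (gshift w) = theta i w"
proof -
  have "(\<exists>j>i + 1. gshift w j < gshift w (i + 1)) \<longleftrightarrow> (\<exists>j>i. w j < w i)"
  proof
    assume "\<exists>j>i + 1. gshift w j < gshift w (i + 1)"
    then obtain j where "j > i + 1" "w (j - 1) < w i" by (auto simp: gshift_def)
    then show "\<exists>j>i. w j < w i" by (intro exI[of _ "j - 1"]) auto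
  next
    assume "\<exists>j>i. w j < w i"
    then obtain j where "j > i" "w j < w i" by blast
    then show "\<exists>j>i + 1. gshift w j < gshift w (i + 1)" by (intro exI[of _ "j + 1"]) (auto simp: gshift_def)
  qed
  then show ?thesis by (simp add: theta_def)
qed

lemma lam_gshift: "lam (i + 1) (gshift w) = lam i w"
  unfolding lam_def
proof (rule sum.reindex_bij_witness[where i="\<lambda>j. j + 1" and j="\<lambda>j. j - 1"])
  fix j assume "j \<in> {j. j \<le> i + 1 \<and> theta j (gshift w) \<noteq> 0}"
  then show "j - 1 \<in> {j. j \<le> i \<and> theta j w \<noteq> 0}" "theta (j - 1) w = theta j (gshift w)"
    using theta_gshift[of "j - 1" w] by auto
qed (auto simp: theta_gshift)

lemma lam_gshift_power: "lam (i + int k) ((gshift ^^ k) w) = lam i w"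
proof (induction k)
  case (Suc k)
  then show ?case using lam_gshift[of "i + int k" "(gshift ^^ k) w"] by (simp add: algebra_simps)
qed simp

lemma gshift_power_S_Zpos: "w \<in> S_Zpos \<Longrightarrow> (gshift ^^ k) w \<in> S_Zpos"
  by (induction k) (simp_all add: gshift_S_Zpos)

lemma gshift_power_surj: "z \<in> S_Z \<Longrightarrow> \<exists>w\<in>S_Z. (gshift ^^ k) w = z"
proof (induction k arbitrary: z)
  case (Suc k)
  obtain w where "w \<in> S_Z" "(gshift ^^ k) w = unshift z" using Suc.IH[OF unshift_S_Z[OF Suc.prems]] by blast
  then show ?case by (intro bexI[of _ w]) simp_all
qed simp

lemma schubert_const_S_Zpos: "schubert_const u v w \<noteq> 0 \<Longrightarrow> w \<in> S_Zpos"
  by (auto simp: schubert_const_def split: if_splits)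

lemma V_set_mono:
  assumes "u \<in> S_Zpos" "v \<in> S_Zpos"
  shows "V_set k u v \<subseteq> V_set (k + 1) u v"
proof
  fix w assume w: "w \<in> V_set k u v"
  then have "(gshift ^^ k) w \<in> S_Zpos" by (auto simp: V_set_def dest: schubert_const_S_Zpos)
  then show "w \<in> V_set (k + 1) u v"
    using w schubert_const_gshift[of "(gshift ^^ k) u" "(gshift ^^ k) v" "(gshift ^^ k) w"] assms
    by (simp add: V_set_def gshift_power_S_Zpos)
qed

text \<open>A term of the \<open>(k + 1)\<close>-fold shifted product comes from stage
  \<open>k\<close> exactly when it is a shift of an element of \<open>S_Zpos\<close>, that is, when
  it fixes 1.\<close>

lemma V_set_stable_iff_fixes_1:
  assumes "u \<in> S_Zpos" "v \<in> S_Zpos"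
  shows "V_set k u v = V_set (k + 1) u v \<longleftrightarrow>
    (\<forall>z. schubert_const (gshift ((gshift ^^ k) u)) (gshift ((gshift ^^ k) v)) z \<noteq> 0 \<longrightarrow> z 1 = 1)"
    (is "?L \<longleftrightarrow> ?R")
proof
  assume L: ?L
  show ?R
  proof (intro allI impI)
    fix z assume z: "schubert_const (gshift ((gshift ^^ k) u)) (gshift ((gshift ^^ k) v)) z \<noteq> 0"
    then have "z \<in> S_Z" using schubert_const_S_Zpos by (auto simp: S_Zpos_def)
    then obtain w where w: "w \<in> S_Z" "(gshift ^^ (k + 1)) w = z" using gshift_power_surj by blast
    then have "w \<in> V_set (k + 1) u v" using z by (simp add: V_set_def)
    then have "w \<in> V_set k u v" using L by simp
    then have "(gshift ^^ k) w \<in> S_Zpos" by (auto simp: V_set_def dest: schubert_const_S_Zpos)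
    then show "z 1 = 1" using w gshift_1 by auto
  qed
next
  assume R: ?R
  have "w \<in> V_set k u v" if "w \<in> V_set (k + 1) u v" for w
  proof -
    let ?z = "gshift ((gshift ^^ k) w)"
    have nz: "schubert_const (gshift ((gshift ^^ k) u)) (gshift ((gshift ^^ k) v)) ?z \<noteq> 0" and w: "w \<in> S_Z"
      using that by (auto simp: V_set_def)
    have "unshift ?z \<in> S_Zpos"
      using R nz schubert_const_S_Zpos by (intro unshift_S_Zpos) blast+
    then have "(gshift ^^ k) w \<in> S_Zpos" by simp
    then show ?thesis
      using nz w schubert_const_gshift[of "(gshift ^^ k) u" "(gshift ^^ k) v" "(gshift ^^ k) w"] assms
      by (simp add: V_set_def gshift_power_S_Zpos)
  qed
  then show ?L using V_set_mono[OF assms, of k] by blast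
qed

lemma V_set_stable_iff:
  assumes "u \<in> S_Zpos" "v \<in> S_Zpos"
  shows "V_set k u v = V_set (k + 1) u v \<longleftrightarrow> (\<forall>i\<ge>0. lam i u + lam i v - i \<le> int k)"
proof -
  let ?u = "gshift ((gshift ^^ k) u)" and ?v = "gshift ((gshift ^^ k) v)"
  have S: "?u \<in> S_Zpos" "?v \<in> S_Zpos" "?u 1 = 1" "?v 1 = 1"
    using assms by (auto simp: gshift_power_S_Zpos gshift_S_Zpos gshift_1)
  \<comment> \<open>Stage \<open>k + 1\<close> concerns \<open>(k + 1)\<close>-fold shifts; with
    \<open>j = i + int k + 1\<close> the bound \<open>j - 1\<close> becomes
    \<open>i + int k\<close>.\<close>
  have lam: "lam j ((gshift ^^ Suc k) w) = lam (j - int k - 1) w" for j w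
    using lam_gshift_power[of "j - int k - 1" "Suc k" w] by simp
  have "V_set k u v = V_set (k + 1) u v \<longleftrightarrow> (\<forall>j\<ge>1. lam j ?u + lam j ?v \<le> j - 1)"
    using V_set_stable_iff_fixes_1[OF assms] product_fixes_1_iff[OF S] by simp
  also have "\<dots> \<longleftrightarrow> (\<forall>j\<ge>1. lam (j - int k - 1) u + lam (j - int k - 1) v \<le> j - 1)"
    using lam by simp
  also have "\<dots> \<longleftrightarrow> (\<forall>i\<ge>0. lam i u + lam i v - i \<le> int k)"
  proof
    assume L: "\<forall>j\<ge>1. lam (j - int k - 1) u + lam (j - int k - 1) v \<le> j - 1"
    show "\<forall>i\<ge>0. lam i u + lam i v - i \<le> int k"
    proof (intro allI impI)
      fix i :: int assume "i \<ge> 0"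
      then show "lam i u + lam i v - i \<le> int k" using L[rule_format, of "i + int k + 1"] by simp
    qed
  next
    assume R: "\<forall>i\<ge>0. lam i u + lam i v - i \<le> int k"
    show "\<forall>j\<ge>1. lam (j - int k - 1) u + lam (j - int k - 1) v \<le> j - 1"
    proof (intro allI impI)
      fix j :: int assume j: "j \<ge> 1"
      show "lam (j - int k - 1) u + lam (j - int k - 1) v \<le> j - 1"
      proof (cases "j - int k - 1 \<ge> 0")
        case True
        then show ?thesis using R[rule_format, OF True] by simp
      next
        case False
        \<comment> \<open>Both values of \<open>lam\<close> vanish at a negative index, leaving
          \<open>0 \<le> j - 1\<close>.\<close>
        then show ?thesis using j assms by (simp add: lam_nonpos)
      qed
    qed
  qed
  finally show ?thesis .
qed

theorem theorem1p3:
  fixes u v :: "int \<Rightarrow> int"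
  assumes "u \<in> S_Zpos" and "v \<in> S_Zpos"
  shows
    "(\<forall>k. V_set k u v \<subseteq> V_set (k + 1) u v) \<and>
     (\<exists>j. \<forall>i\<ge>j. V_set i u v = V_set (i + 1) u v) \<and>
     BS u v = St u v \<and>
     int (BS u v) \<le> Max (insert 0 {i. theta i u = 1 \<or> theta i v = 1}) \<and>
     (\<exists>i\<ge>0. int (BS u v) = lam i u + lam i v - i) \<and>
     (\<forall>i\<ge>0. lam i u + lam i v - i \<le> int (BS u v))"
proof -
  define T where "T = {i. theta i u = 1 \<or> theta i v = 1}"
  \<comment> \<open>The inserted 0 covers the case of empty \<open>T\<close>, where
    \<open>Max T\<close> is unspecified.\<close>
  define M where "M = Max (insert 0 T)"
  define K where "K i = lam i u + lam i v - i" for i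
  have "finite {i. theta i w = 1}" if w: "w \<in> S_Zpos" for w
  proof -
    obtain n where "perm_on n w" using S_Zpos_perm_on w by blast
    then have "theta i w = 0" if "i > int n" for i
      using theta_incr[OF incr_mono[OF perm_on_incr]] that by simp
    then have "1 \<le> i \<and> i \<le> int n" if "theta i w = 1" for i
      using theta_nonpos[OF w, of i] that by (metis linorder_not_le one_neq_zero zero_less_one add_0 zless_imp_add1_zle)
    then have "{i. theta i w = 1} \<subseteq> {1..int n}" by auto
    then show ?thesis by (rule finite_subset) simp
  qed
  then have finT: "finite T" using assms by (auto simp: T_def Collect_disj_eq)
  have TM: "i \<le> M" if "theta i u \<noteq> 0 \<or> theta i v \<noteq> 0" for i
    unfolding M_def using finT that by (intro Max_ge) (auto simp: T_def theta_def split: if_splits)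
  have M0: "M \<ge> 0" unfolding M_def using finT by simp
  \<comment> \<open>Beyond \<open>M\<close> both \<open>lam\<close> are constant, so
    \<open>K\<close> decreases there and its maximum is attained on \<open>{0..M}\<close>.\<close>
  have const: "lam i u = lam M u" "lam i v = lam M v" if "i \<ge> M" for i
  proof -
    have "{j. j \<le> i \<and> theta j u \<noteq> 0} = {j. j \<le> M \<and> theta j u \<noteq> 0}"
      "{j. j \<le> i \<and> theta j v \<noteq> 0} = {j. j \<le> M \<and> theta j v \<noteq> 0}"
      using TM that by fastforce+
    then show "lam i u = lam M u" "lam i v = lam M v" by (simp_all add: lam_def)
  qed
  define k0 where "k0 = Max (K ` {0..M})"
  have "k0 \<in> K ` {0..M}" unfolding k0_def using M0 by (intro Max_in) auto
  then obtain i0 where i0: "0 \<le> i0" "i0 \<le> M" "k0 = K i0" by auto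
  have le: "K i \<le> k0" if "i \<ge> 0" for i
  proof (cases "i \<le> M")
    case True
    then show ?thesis unfolding k0_def using that by (intro Max_ge) auto
  next
    case False
    then have "K i \<le> K M" using const[of i] by (simp add: K_def)
    also have "K M \<le> k0" unfolding k0_def using M0 by (intro Max_ge) auto
    finally show ?thesis .
  qed
  have "k0 \<ge> 0" using le[of 0] assms by (simp add: K_def lam_nonpos)
  \<comment> \<open>Each \<open>lam\<close> at \<open>i0\<close> is at most \<open>i0\<close>, hence
    \<open>K i0 \<le> i0 \<le> M\<close>.\<close>
  have "k0 \<le> M"
    using i0 lam_le[OF assms(1), of "nat i0"] lam_le[OF assms(2), of "nat i0"] by (simp add: K_def)
  \<comment> \<open>Stability is upward closed in \<open>k\<close>, so the first stable stage
    already begins permanent stability and both minima are \<open>nat k0\<close>.\<close>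
  have stable: "V_set k u v = V_set (k + 1) u v \<longleftrightarrow> nat k0 \<le> k" for k
    unfolding V_set_stable_iff[OF assms] K_def[symmetric] using le i0 by (auto simp: nat_le_iff intro: order_trans)
  have St: "St u v = nat k0"
    unfolding St_def stable by (rule Least_equality) auto
  have BS: "BS u v = nat k0"
    unfolding BS_def stable by (rule Least_equality) auto
  show ?thesis
    using V_set_mono[OF assms] stable St BS \<open>k0 \<le> M\<close> \<open>k0 \<ge> 0\<close> i0 le
    unfolding M_def T_def K_def by (auto intro!: exI[of _ "nat k0"] exI[of _ i0])
qed

end
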